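(* For every $0<\varepsilon<1$ and every $T\geq 1$, there exists $C_{\varepsilon,T}>0$ such that the following holds. Let $N=tq$, where $t,q$ are positive integers with $1\leq t\leq T$ and $(t,q)=1$, and put $\lambda=P^-(q)$. Let $A\subseteq\mathbb Z_N$ have size $n\geq 2$, and let $R$ be a uniformly random $m$-subset of $A$, where $1\leq m\leq(1-\varepsilon)n$. Then, for every $z\in\mathbb Z_N$, $$\Pr[\Sigma(R)=z]\leq\frac1N+C_{\varepsilon,T}\left(\frac{\sqrt{\log(2+n)}}{n\sqrt m}+\frac1\lambda\right),$$ where $1/\lambda$ is interpreted as $0$ when $q=1$.
   Context: $P^-(q)$ denotes the least prime divisor of $q$ (with $P^-(1)=\infty$). $\Sigma(R)=\sum_{x\in R}x$. $\log$ is the natural logarithm. An $m$-subset is a subset of size $m$. *)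

theory Defs
  imports "HOL-Probability.Probability" "HOL-Number_Theory.Number_Theory"
begin

text \<open>
  The cyclic group of order \<open>N\<close> is represented by the integers \<open>{0..<int N}\<close>;
  equality of elements is congruence modulo \<open>N\<close>.
\<close>

text \<open>The infimum of the empty set is \<open>\<infinity>\<close> in \<^typ>\<open>enat\<close>, so \<open>P_minus 1 = \<infinity>\<close>.\<close>

definition P_minus :: "nat \<Rightarrow> enat" where
  "P_minus q = (INF p\<in>{p. prime p \<and> p dvd q}. enat p)"

definition subset_sum :: "int set \<Rightarrow> int" where
  "subset_sum R = (\<Sum>x\<in>R. x)"

definition random_subset :: "nat \<Rightarrow> 'a set \<Rightarrow> 'a set pmf" where
  "random_subset m A = pmf_of_set {R. R \<subseteq> A \<and> card R = m}"

lemma P_minus_one: "P_minus 1 = \<infinity>"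
proof -
  have "{p::nat. prime p \<and> p dvd 1} = {}" by auto
  then show ?thesis unfolding P_minus_def by (simp only: image_empty Inf_empty top_enat_def)
qed

lemma P_minus_eq_Least:
  assumes "q \<noteq> 1"
  shows "P_minus q = enat (LEAST p. prime p \<and> p dvd q)"
proof -
  let ?P = "\<lambda>p::nat. prime p \<and> p dvd q"
  from prime_factor_nat[OF assms] have ex: "\<exists>p. ?P p" by blast
  have "P_minus q \<le> enat (Least ?P)"
    unfolding P_minus_def using LeastI_ex[OF ex] by (intro INF_lower) simp
  moreover have "enat (Least ?P) \<le> P_minus q"
    unfolding P_minus_def by (intro INF_greatest) (auto intro: Least_le)
  ultimately show ?thesis by (rule antisym)
qed

text \<open>In \<^typ>\<open>ereal\<close>, \<open>1 / \<infinity> = 0\<close>, so the reciprocal of \<open>P_minus q\<close> vanishes for \<open>q = 1\<close>.\<close>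

lemma inverse_P_minus_one: "real_of_ereal (1 / ereal_of_enat (P_minus 1)) = 0"
  unfolding P_minus_one by simp

end

theory Submission
  imports Defs "HOL-Library.Real_Mod"
begin

text \<open>
  Reducing modulo \<open>q\<close> only increases the probability, and by Fourier inversion it is then at most the
  average over \<open>r\<close> of \<open>|F r|\<close>, where \<open>F r\<close> is the \<open>m\<close>-th elementary symmetric mean of the numbers
  \<open>e(ra/q)\<close>, \<open>a \<in> A\<close>. Viewing the random \<open>m\<close>-subset as a Bernoulli sample of density \<open>m/n\<close> conditioned on
  its size, one gets \<open>|F r| \<le> C exp (- \<epsilon> m \<delta>(r)\<^sup>2)\<close> where \<open>1 - 2 \<delta>(r)\<^sup>2 = |\<Sum> e(ra/q)|\<^sup>2 / n\<^sup>2\<close>, except where the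
  trigonometric sum is smaller than \<open>n/2\<close>; there one only has \<open>|F r| \<le> C \<surd>m exp (- \<epsilon> m / 2)\<close>, which suffices once
  \<open>m\<close> exceeds a multiple of \<open>log n\<close>. For smaller \<open>m\<close> the logarithm in the claim absorbs the trivial bound
  \<open>1 / (n - m + 1)\<close>.

  The function \<open>\<delta>\<close> is subadditive, and by Parseval its ball of a fixed radius has \<open>O(tq/n)\<close> elements.
  Packing translates of a ball of radius \<open>s\<close> into that ball shows that it has \<open>O(s t q/n)\<close> elements, unless
  it lies in a proper subgroup and so has at most \<open>q/\<lambda>\<close>. Summing \<open>exp (- \<epsilon> m \<delta>(r)\<^sup>2)\<close> over the level sets
  gives the claim.
\<close>

subsection \<open>Orthogonality and the binomial mode\<close>

lemma sum_cis_orthogonality: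
  fixes q :: nat and k :: int
  assumes "0 < q"
  shows "(\<Sum>r<q. cis (2 * pi * real r * real_of_int k / real q)) = (if int q dvd k then of_nat q else 0)"
proof -
  define x where "x = cis (2 * pi * real_of_int k / real q)"
  have pow: "cis (2 * pi * real r * real_of_int k / real q) = x ^ r" for r
    unfolding x_def Complex.DeMoivre by (rule arg_cong[of _ _ cis]) (simp add: field_simps)
  have x1: "x = 1 \<longleftrightarrow> int q dvd k"
  proof
    assume "x = 1"
    then obtain j :: int where j: "2 * pi * real_of_int k / real q = of_int j * (2 * pi)"
      unfolding x_def cis_eq_1_iff by blast
    then have "real_of_int k = real_of_int (int q * j)"
      using assms by (simp add: field_simps)
    then have "k = int q * j" by linarith
    then show "int q dvd k" by simp
  next
    assume "int q dvd k"
    then obtain j where "k = int q * j" by blast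
    then show "x = 1"
      unfolding x_def cis_eq_1_iff using assms by (intro exI[of _ j]) (simp add: field_simps)
  qed
  have xq: "x ^ q = 1"
    unfolding x_def Complex.DeMoivre cis_eq_1_iff using assms by (intro exI[of _ k]) (simp add: field_simps)
  show ?thesis
  proof (cases "int q dvd k")
    case True
    then show ?thesis using x1 by (simp add: pow)
  next
    case False
    then have "x \<noteq> 1" using x1 by simp
    then have "(\<Sum>r<q. x ^ r) = 0" using xq by (simp add: sum_gp_strict)
    then show ?thesis using False by (simp add: pow)
  qed
qed

lemma Bernstein_variance:
  "(\<Sum>k\<le>n. (real k - real n * x)\<^sup>2 * Bernstein n k x) = real n * x * (1 - x)"
proof -
  \<comment> \<open>The square is written in terms of k(k-1), k and 1, whose sums against the
    Bernstein polynomials are known.\<close>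
  have *: "(a - b)\<^sup>2 * c = a * (a - 1) * c + (1 - 2 * b) * a * c + b * b * c" for a b c :: real
    by (simp add: algebra_simps power2_eq_square)
  show ?thesis
    apply (simp add: * sum.distrib)
    apply (simp flip: sum_distrib_left add: mult.assoc)
    apply (simp add: algebra_simps power2_eq_square)
    done
qed

lemma real_binomial_Suc_ratio:
  assumes "k < n"
  shows "real (Suc k) * real (n choose Suc k) = real (n - k) * real (n choose k)"
proof -
  have "Suc k * (n choose Suc k) = (n - k) * (n choose k)"
    using assms by (metis Suc_pred' binomial_absorb_comp binomial_absorption diff_Suc_1 gr_implies_not0 not_gr_zero)
  then show ?thesis by (simp only: of_nat_mult[symmetric])
qed

lemma Bernstein_Suc_ratio:
  assumes "k < n"
  shows "real (Suc k) * (1 - x) * Bernstein n (Suc k) x = real (n - k) * x * Bernstein n k x"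
proof -
  note * = real_binomial_Suc_ratio[OF assms]
  have "n - k = Suc (n - Suc k)" using assms by simp
  then have "(1 - x) ^ (n - k) = (1 - x) * (1 - x) ^ (n - Suc k)" by (simp only: power_Suc)
  then have "real (Suc k) * (1 - x) * Bernstein n (Suc k) x =
      (real (Suc k) * real (n choose Suc k)) * x * x ^ k * (1 - x) ^ (n - k)"
    unfolding Bernstein_def by (simp add: mult_ac)
  then show ?thesis unfolding Bernstein_def * by (simp add: mult_ac)
qed

text \<open>With x = m/n, the ratio of the terms j+1 and j is (n-j)x / ((j+1)(1-x)). It is at least
  1 for j < m and at most 1 for j >= m, so the sequence climbs up to m and descends after
  it.\<close>

lemma Bernstein_mode:
  assumes "0 < m" "m < n" "k \<le> n"
  shows "Bernstein n k (real m / real n) \<le> Bernstein n m (real m / real n)"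
proof -
  let ?x = "real m / real n"
  let ?b = "\<lambda>k. Bernstein n k ?x"
  have x: "0 < ?x" "?x < 1" using assms by auto
  have x': "1 - ?x = (real n - real m) / real n" using assms by (simp add: field_simps)
  have pos: "0 < ?b j" if "j \<le> n" for j using x that by (intro Bernstein_pos)
  have up: "?b j \<le> ?b (Suc j)" if "j < m" for j
  proof -
    have j: "j < n" using that assms by simp
    have "real (Suc j) * (real n - real m) \<le> (real n - real j) * real m"
    proof -
      have "real (Suc j) * real n \<le> real m * real n" using that by (intro mult_right_mono) auto
      then show ?thesis by (simp add: algebra_simps)
    qed
    then have "real (Suc j) * (1 - ?x) \<le> real (n - j) * ?x"
      using j unfolding x' by (simp add: divide_right_mono)
    then have "real (Suc j) * (1 - ?x) * ?b j \<le> real (n - j) * ?x * ?b j"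
      using pos[of j] j by (intro mult_right_mono) auto
    also have "\<dots> = real (Suc j) * (1 - ?x) * ?b (Suc j)"
      using Bernstein_Suc_ratio[OF j] by simp
    finally show ?thesis using x by (simp add: mult_le_cancel_left)
  qed
  have down: "?b (Suc j) \<le> ?b j" if "m \<le> j" "j < n" for j
  proof -
    have "(real n - real j) * real m \<le> real (Suc j) * (real n - real m)"
    proof -
      have "real m * real n \<le> real j * real n" using that by (intro mult_right_mono) auto
      moreover have "real m \<le> real n" using assms by simp
      ultimately show ?thesis by (simp add: algebra_simps)
    qed
    then have "real (n - j) * ?x \<le> real (Suc j) * (1 - ?x)"
      using that unfolding x' by (simp add: divide_right_mono)
    then have "real (n - j) * ?x * ?b j \<le> real (Suc j) * (1 - ?x) * ?b j"
      using pos[of j] that by (intro mult_right_mono) auto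
    then have "real (Suc j) * (1 - ?x) * ?b (Suc j) \<le> real (Suc j) * (1 - ?x) * ?b j"
      using Bernstein_Suc_ratio[OF that(2), of ?x] by simp
    then show ?thesis using x by (simp add: mult_le_cancel_left)
  qed
  show ?thesis
  proof (cases "k \<le> m")
    case True
    then show ?thesis
      by (induction k rule: inc_induct) (auto intro: order_trans up)
  next
    case False
    then have "m \<le> k" by simp
    then show ?thesis using assms(3)
      by (induction k rule: dec_induct) (auto intro: order_trans[OF down])
  qed
qed

text \<open>Chebyshev's inequality: the variance is at most m, so three quarters of the mass lies
  within 2 sqrt m of m. That window holds at most 5 sqrt m integers, and none of them exceeds the
  mode.\<close>

lemma Bernstein_mode_lower:
  assumes "0 < m" "m < n"
  shows "1 / (8 * sqrt (real m)) \<le> Bernstein n m (real m / real n)"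
proof -
  let ?x = "real m / real n"
  let ?b = "\<lambda>k. Bernstein n k ?x"
  define L where "L = nat \<lceil>2 * sqrt (real m)\<rceil>"
  have x: "0 < ?x" "?x < 1" using assms by auto
  have s1: "1 \<le> sqrt (real m)" using assms by simp
  have L: "2 * sqrt (real m) \<le> real L" "real L \<le> 2 * sqrt (real m) + 1"
    unfolding L_def using s1 by linarith+
  have nn: "0 \<le> ?b j" for j using x by (intro Bernstein_nonneg) auto
  have var: "(\<Sum>k\<le>n. (real k - real m)\<^sup>2 * ?b k) \<le> real m"
  proof -
    have "(\<Sum>k\<le>n. (real k - real m)\<^sup>2 * ?b k) = real m * (1 - ?x)"
      using Bernstein_variance[of n ?x] assms by simp
    also have "\<dots> \<le> real m * 1" using x by (intro mult_left_mono) auto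
    finally show ?thesis by simp
  qed
  \<comment> \<open>At most 2L-1 indices; truncated subtraction only cuts the window off at 0. Every
    index outside is at distance at least L from m.\<close>
  let ?I = "{m - (L - 1)..m + (L - 1)}"
  have pt: "?b k \<le> (if k \<in> ?I then ?b m else 0) + (real k - real m)\<^sup>2 * ?b k / (4 * real m)"
    if "k \<le> n" for k
  proof (cases "k \<in> ?I")
    case True
    then show ?thesis using Bernstein_mode[OF assms that] nn[of k] by (simp add: add_increasing2)
  next
    case False
    have "real L \<le> \<bar>real k - real m\<bar>" using False by auto
    then have "2 * sqrt (real m) \<le> \<bar>real k - real m\<bar>" using L by simp
    then have "(2 * sqrt (real m))\<^sup>2 \<le> (real k - real m)\<^sup>2"
      by (metis abs_le_square_iff abs_of_nonneg mult_nonneg_nonneg real_sqrt_ge_zero of_nat_0_le_iff zero_le_numeral)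
    then have "4 * real m \<le> (real k - real m)\<^sup>2" by (simp add: power_mult_distrib)
    then have "?b k * (4 * real m) \<le> ?b k * (real k - real m)\<^sup>2" using nn by (intro mult_left_mono)
    then have "?b k \<le> (real k - real m)\<^sup>2 * ?b k / (4 * real m)"
      using assms by (simp add: field_simps)
    moreover have "\<not> (k \<in> ?I)" by (rule False)
    ultimately show ?thesis by (simp only: if_False add_0)
  qed
  have "1 = (\<Sum>k\<le>n. ?b k)" by simp
  also have "\<dots> \<le> (\<Sum>k\<le>n. (if k \<in> ?I then ?b m else 0) + (real k - real m)\<^sup>2 * ?b k / (4 * real m))"
    using pt by (intro sum_mono) auto
  also have "\<dots> = (\<Sum>k\<le>n. if k \<in> ?I then ?b m else 0) + (\<Sum>k\<le>n. (real k - real m)\<^sup>2 * ?b k) / (4 * real m)"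
    by (simp add: sum.distrib sum_divide_distrib)
  also have "(\<Sum>k\<le>n. if k \<in> ?I then ?b m else 0) = (\<Sum>k\<in>{..n} \<inter> ?I. ?b m)"
    by (subst sum.inter_restrict) auto
  also have "\<dots> \<le> (\<Sum>k\<in>?I. ?b m)" using nn by (intro sum_mono2) auto
  also have "\<dots> = real (card ?I) * ?b m" by simp
  also have "\<dots> \<le> (2 * real L - 1) * ?b m"
  proof -
    have "1 \<le> L" using L(1) s1 by linarith
    then have "real (card ?I) \<le> 2 * real L - 1" by (auto simp: of_nat_diff)
    then show ?thesis using nn by (intro mult_right_mono)
  qed
  also have "(\<Sum>k\<le>n. (real k - real m)\<^sup>2 * ?b k) / (4 * real m) \<le> real m / (4 * real m)"
    using var by (intro divide_right_mono) auto
  also have "real m / (4 * real m) = 1 / 4" using assms by simp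
  finally have "3 / 4 \<le> (2 * real L - 1) * ?b m" by simp
  also have "\<dots> \<le> (5 * sqrt (real m)) * ?b m"
    using nn by (intro mult_right_mono) (use L s1 in linarith)
  finally have "3 / 4 \<le> 5 * sqrt (real m) * ?b m" .
  then show ?thesis using s1 by (simp add: field_simps)
qed

section \<open>Elementary symmetric means of points on the unit circle\<close>

text \<open>Coefficient extraction: the product is a polynomial in the root of unity, whose terms
  are indexed by the subsets of \<open>A\<close>. As M exceeds its degree, distinct subset sizes
  stay distinct modulo M, and summing over all M-th roots of unity isolates the coefficient of
  degree m.\<close>

lemma esym_roots_of_unity:
  fixes \<zeta> :: "'a \<Rightarrow> complex" and c d :: complex
  assumes "finite A" "card A < M" "m \<le> card A"
  shows "(\<Sum>j<M. cis (- (2 * pi * real j * real m / real M)) *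
             (\<Prod>a\<in>A. c + d * cis (2 * pi * real j / real M) * \<zeta> a))
       = of_nat M * d ^ m * c ^ (card A - m) * (\<Sum>R | R \<subseteq> A \<and> card R = m. \<Prod>a\<in>R. \<zeta> a)"
proof -
  have M: "0 < M" using assms by simp
  let ?w = "\<lambda>j. cis (2 * pi * real j / real M)"
  let ?v = "\<lambda>j. cis (- (2 * pi * real j * real m / real M))"
  let ?P = "\<lambda>X. \<Prod>a\<in>X. \<zeta> a"
  have fin: "finite X" if "X \<in> Pow A" for X using that assms finite_subset by auto
  have cardX: "card X \<le> card A" if "X \<in> Pow A" for X using that assms by (simp add: card_mono)
  have ex: "(\<Prod>a\<in>A. c + d * ?w j * \<zeta> a)
      = (\<Sum>X\<in>Pow A. d ^ card X * ?w j ^ card X * ?P X * c ^ (card A - card X))" for j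
  proof -
    have "(\<Prod>a\<in>A. c + d * ?w j * \<zeta> a) = (\<Prod>a\<in>A. d * ?w j * \<zeta> a + c)"
      by (simp add: add.commute)
    also have "\<dots> = (\<Sum>X\<in>Pow A. (\<Prod>a\<in>X. d * ?w j * \<zeta> a) * (\<Prod>a\<in>A-X. c))"
      by (rule prod_add[OF assms(1)])
    also have "\<dots> = (\<Sum>X\<in>Pow A. d ^ card X * ?w j ^ card X * ?P X * c ^ (card A - card X))"
      using assms fin by (intro sum.cong refl) (auto simp: prod.distrib card_Diff_subset power_mult_distrib)
    finally show ?thesis .
  qed
  have orth: "(\<Sum>j<M. ?v j * ?w j ^ card X) = (if card X = m then of_nat M else 0)"
    if "X \<in> Pow A" for X
  proof -
    have "?v j * ?w j ^ card X = cis (2 * pi * real j * real_of_int (int (card X) - int m) / real M)" for j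
      unfolding Complex.DeMoivre cis_mult
      by (rule arg_cong[of _ _ cis]) (simp add: right_diff_distrib diff_divide_distrib mult_ac)
    then have "(\<Sum>j<M. ?v j * ?w j ^ card X)
        = (if int M dvd int (card X) - int m then of_nat M else 0)"
      using sum_cis_orthogonality[OF M, of "int (card X) - int m"] by simp
    moreover have "int M dvd int (card X) - int m \<longleftrightarrow> card X = m"
    proof
      assume "int M dvd int (card X) - int m"
      moreover have "\<bar>int (card X) - int m\<bar> < int M"
        using cardX[OF that] assms by auto
      ultimately show "card X = m"
        using zdvd_not_zless[of "\<bar>int (card X) - int m\<bar>" "int M"] by auto
    qed simp
    ultimately show ?thesis by simp
  qed
  have "(\<Sum>j<M. ?v j * (\<Prod>a\<in>A. c + d * ?w j * \<zeta> a))
      = (\<Sum>j<M. \<Sum>X\<in>Pow A. ?v j * (d ^ card X * ?w j ^ card X * ?P X * c ^ (card A - card X)))"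
    by (simp add: ex sum_distrib_left)
  also have "\<dots> = (\<Sum>X\<in>Pow A. \<Sum>j<M. ?v j * (d ^ card X * ?w j ^ card X * ?P X * c ^ (card A - card X)))"
    by (rule sum.swap)
  also have "\<dots> = (\<Sum>X\<in>Pow A. (d ^ card X * ?P X * c ^ (card A - card X)) * (\<Sum>j<M. ?v j * ?w j ^ card X))"
    by (simp add: sum_distrib_left mult_ac)
  also have "\<dots> = (\<Sum>X\<in>Pow A. if card X = m then of_nat M * d ^ m * c ^ (card A - m) * ?P X else 0)"
    by (intro sum.cong refl) (auto simp: orth)
  also have "\<dots> = (\<Sum>X | X \<in> Pow A \<and> card X = m. of_nat M * d ^ m * c ^ (card A - m) * ?P X)"
    using assms(1) by (subst sum.inter_filter) auto
  finally show ?thesis by (simp add: sum_distrib_left Pow_def)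
qed

text \<open>The squared norm equals 1 - 2p(1-p)(1 - Re u) exactly; then 1 + x <= exp x
  applies.\<close>

lemma norm_convex_unit_le:
  fixes u :: complex and p :: real
  assumes "norm u = 1" "0 \<le> p" "p \<le> 1"
  shows "norm (of_real (1 - p) + of_real p * u) \<le> exp (- (p * (1 - p) * (1 - Re u)))"
proof -
  have u: "(Re u)\<^sup>2 + (Im u)\<^sup>2 = 1" using assms(1) by (simp add: cmod_def)
  have "(norm (of_real (1 - p) + of_real p * u))\<^sup>2 = (1 - p + p * Re u)\<^sup>2 + (p * Im u)\<^sup>2"
    by (simp add: cmod_power2)
  also have "\<dots> = (1 - p)\<^sup>2 + 2 * p * (1 - p) * Re u + p\<^sup>2 * ((Re u)\<^sup>2 + (Im u)\<^sup>2)"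
    by (simp add: power2_eq_square algebra_simps)
  also have "\<dots> = 1 + (- (2 * (p * (1 - p) * (1 - Re u))))"
    unfolding u by (simp add: power2_eq_square algebra_simps)
  also have "\<dots> \<le> exp (- (2 * (p * (1 - p) * (1 - Re u))))" by (rule exp_ge_add_one_self)
  also have "\<dots> = (exp (- (p * (1 - p) * (1 - Re u))))\<^sup>2"
    by (simp flip: exp_double)
  finally show ?thesis by (rule power2_le_imp_le) simp
qed

text \<open>With p = m/n, the products over \<open>A\<close> form the characteristic function of a
  Bernoulli sample, and the sum over j selects the samples of size m. Conditioning on that size
  costs the factor 8 sqrt m. The variance np(1-p) of the sample size is \<kappa>.\<close>

lemma norm_esym_le:
  fixes \<zeta> :: "'a \<Rightarrow> complex"
  assumes "finite A" "card A = n" "0 < m" "m < n" and unit: "\<And>a. a \<in> A \<Longrightarrow> norm (\<zeta> a) = 1"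
    and M: "M = Suc n" and \<kappa>: "\<kappa> = real m * (1 - real m / real n)"
  shows "norm (\<Sum>R | R \<subseteq> A \<and> card R = m. \<Prod>a\<in>R. \<zeta> a) / real (n choose m)
     \<le> 8 * sqrt (real m) *
       ((\<Sum>j<M. exp (- (\<kappa> * (1 - cmod (\<Sum>a\<in>A. \<zeta> a) / real n * cos (2 * pi * real j / real M))))) / real M)"
proof -
  let ?E = "\<lambda>\<zeta>. (\<Sum>R | R \<subseteq> A \<and> card R = m. \<Prod>a\<in>R. \<zeta> a)"
  define p where "p = real m / real n"
  have p: "0 < p" "p < 1" using assms unfolding p_def by auto
  define Z where "Z = (\<Sum>a\<in>A. \<zeta> a)"
  \<comment> \<open>Rotating all \<open>\<zeta> a\<close> by \<open>u\<close> preserves the norm of the symmetric polynomial, so that \<open>Z \<ge> 0\<close> may be assumed.\<close>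
  define u where "u = (if Z = 0 then 1 else cnj (sgn Z))"
  have u: "norm u = 1" unfolding u_def by (simp add: norm_sgn)
  have uZ: "u * Z = of_real (cmod Z)"
  proof (cases "Z = 0")
    case False
    then have "cnj (sgn Z) * Z = (cmod Z)\<^sup>2 / cmod Z"
      unfolding sgn_eq using complex_norm_square[of Z] by (simp add: mult.commute)
    then show ?thesis using False unfolding u_def by (simp add: power2_eq_square)
  qed (simp add: u_def)
  define \<xi> where "\<xi> a = u * \<zeta> a" for a
  have \<xi>: "norm (\<xi> a) = 1" if "a \<in> A" for a using unit[OF that] u by (simp add: \<xi>_def norm_mult)
  have sum\<xi>: "(\<Sum>a\<in>A. \<xi> a) = of_real (cmod Z)"
    unfolding uZ[symmetric] by (simp add: \<xi>_def Z_def sum_distrib_left)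
  have E\<xi>: "norm (?E \<xi>) = norm (?E \<zeta>)"
  proof -
    have "?E \<xi> = (\<Sum>R | R \<subseteq> A \<and> card R = m. u ^ m * (\<Prod>a\<in>R. \<zeta> a))"
      unfolding \<xi>_def by (intro sum.cong refl) (auto simp: prod.distrib)
    also have "\<dots> = u ^ m * ?E \<zeta>" by (simp add: sum_distrib_left)
    finally show ?thesis using u by (simp add: norm_mult norm_power)
  qed
  let ?w = "\<lambda>j. cis (2 * pi * real j / real M)"
  let ?f = "\<lambda>j. exp (- (\<kappa> * (1 - cmod Z / real n * cos (2 * pi * real j / real M))))"
  have factors: "norm (\<Prod>a\<in>A. of_real (1 - p) + of_real p * ?w j * \<xi> a) \<le> ?f j" for j
  proof -
    have "norm (\<Prod>a\<in>A. of_real (1 - p) + of_real p * ?w j * \<xi> a)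
        = (\<Prod>a\<in>A. norm (of_real (1 - p) + of_real p * (?w j * \<xi> a)))"
      by (simp add: prod_norm mult.assoc)
    also have "\<dots> \<le> (\<Prod>a\<in>A. exp (- (p * (1 - p) * (1 - Re (?w j * \<xi> a)))))"
      using p \<xi> by (intro prod_mono conjI norm_convex_unit_le) (auto simp: norm_mult)
    also have "\<dots> = exp (\<Sum>a\<in>A. - (p * (1 - p) * (1 - Re (?w j * \<xi> a))))"
      using assms by (simp only: exp_sum)
    also have "(\<Sum>a\<in>A. - (p * (1 - p) * (1 - Re (?w j * \<xi> a))))
        = - (p * (1 - p) * (real n - Re (?w j * (\<Sum>a\<in>A. \<xi> a))))"
      unfolding sum_negf sum_distrib_left[symmetric] sum_subtractf Re_sum[symmetric]
      using assms by simp
    also have "\<dots> = - (\<kappa> * (1 - cmod Z / real n * cos (2 * pi * real j / real M)))"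
      unfolding sum\<xi> \<kappa> p_def using assms by (simp add: field_simps)
    finally show ?thesis .
  qed
  have "real M * (p ^ m * (1 - p) ^ (n - m) * norm (?E \<xi>))
      = norm (of_nat M * complex_of_real p ^ m * of_real (1 - p) ^ (n - m) * ?E \<xi>)"
    using p by (simp add: norm_mult norm_power del: of_real_diff)
  also have "\<dots> = norm (\<Sum>j<M. cis (- (2 * pi * real j * real m / real M)) *
             (\<Prod>a\<in>A. of_real (1 - p) + of_real p * ?w j * \<xi> a))"
    using esym_roots_of_unity[OF assms(1), of M m "of_real (1 - p)" "of_real p" \<xi>] assms by simp
  also have "\<dots> \<le> (\<Sum>j<M. ?f j)"
    using factors by (intro sum_norm_le) (simp add: norm_mult)
  finally have main: "p ^ m * (1 - p) ^ (n - m) * norm (?E \<zeta>) \<le> (\<Sum>j<M. ?f j) / real M"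
    unfolding E\<xi> using M by (simp add: field_simps)
  \<comment> \<open>The probability that the Bernoulli sample has exactly m elements; dividing by it
    turns the weighted sum into the mean over m-subsets.\<close>
  define b where "b = Bernstein n m p"
  have b: "1 / (8 * sqrt (real m)) \<le> b"
    unfolding b_def p_def using Bernstein_mode_lower assms by blast
  have s: "0 < sqrt (real m)" using assms by simp
  have ch: "0 < real (n choose m)" using assms by simp
  have "norm (?E \<zeta>) / real (n choose m) * (1 / (8 * sqrt (real m))) \<le> norm (?E \<zeta>) / real (n choose m) * b"
    using b by (intro mult_left_mono) auto
  also have "\<dots> = p ^ m * (1 - p) ^ (n - m) * norm (?E \<zeta>)"
    unfolding b_def Bernstein_def using ch by simp
  also have "\<dots> \<le> (\<Sum>j<M. ?f j) / real M" by (rule main)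
  finally have le: "norm (?E \<zeta>) / real (n choose m) * (1 / (8 * sqrt (real m))) \<le> (\<Sum>j<M. ?f j) / real M" .
  have "a \<le> c * b" if "a * (1 / c) \<le> b" "0 < c" for a b c :: real
    using that by (simp add: field_simps)
  from this[OF le] show ?thesis using s unfolding Z_def by simp
qed

text \<open>Up to pi/3 the difference has derivative cos y - 1/2 >= 0. Beyond that, sin x >= sqrt 3
  / 2 >= pi/4 >= x/2.\<close>

lemma sin_ge_half:
  assumes "0 \<le> x" "x \<le> pi / 2"
  shows "x / 2 \<le> sin (x::real)"
proof (cases "x \<le> pi / 3")
  case True
  define f where "f y = sin y - y / 2" for y :: real
  have "f 0 \<le> f x"
  proof (rule DERIV_nonneg_imp_nondecreasing[OF assms(1)])
    fix y assume y: "0 \<le> y" "y \<le> x"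
    have "(f has_real_derivative cos y - 1 / 2) (at y)"
      unfolding f_def by (auto intro!: derivative_eq_intros)
    moreover have "cos (pi / 3) \<le> cos y"
      using y True by (subst cos_mono_le_eq) auto
    ultimately show "\<exists>d. (f has_real_derivative d) (at y) \<and> 0 \<le> d"
      by (auto simp: cos_60)
  qed
  then show ?thesis by (simp add: f_def)
next
  case False
  have "sin (pi / 3) \<le> sin x"
    using False assms by (subst sin_mono_le_eq) auto
  moreover have "pi / 4 \<le> sqrt 3 / 2"
  proof -
    have "pi / 2 \<le> 1.6" using pi_less_4 pi_approx by simp
    also have "1.6 \<le> sqrt (3::real)" by (rule real_le_rsqrt) (simp add: power2_eq_square)
    finally show ?thesis by simp
  qed
  ultimately show ?thesis using assms by (simp add: sin_60)
qed

lemma sum_exp_neg_le: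
  fixes u :: real
  assumes "0 < u"
  shows "(\<Sum>i<M. exp (- (u * real i))) \<le> 1 + 1 / u"
proof -
  have y: "exp (- u) < 1" "0 < exp (-u)" using assms by auto
  have "(\<Sum>i<M. exp (- (u * real i))) = (\<Sum>i<M. exp (- u) ^ i)"
    by (simp flip: exp_of_nat_mult add: mult.commute)
  also have "\<dots> = (1 - exp (- u) ^ M) / (1 - exp (- u))"
    using y by (simp add: sum_gp_strict)
  also have "\<dots> \<le> 1 / (1 - exp (- u))"
    using y by (intro divide_right_mono) auto
  also have "\<dots> \<le> 1 + 1 / u"
  proof -
    have "1 + u \<le> exp u" by simp
    then have "exp (- u) \<le> 1 / (1 + u)" using assms by (simp add: exp_minus field_simps)
    then have "u / (1 + u) \<le> 1 - exp (- u)" using assms by (simp add: field_simps)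
    then have "1 / (1 - exp (- u)) \<le> 1 / (u / (1 + u))"
      using assms y by (intro divide_left_mono) auto
    also have "\<dots> = 1 + 1 / u" using assms by (simp add: field_simps)
    finally show ?thesis .
  qed
  finally show ?thesis .
qed

text \<open>Split 1 - \<rho> cos y as (1 - \<rho>) + \<rho>(1 - cos y). Since \<rho> >= 1/2, the
  second part dominates (x/M)^2 for y = 2 pi x / M with 0 <= x <= M/2, so the summands decay on the
  scale M / sqrt \<kappa> and their average gains a factor of order 1 / sqrt \<kappa>.\<close>

lemma average_exp_cos_le:
  fixes \<kappa> \<rho> :: real
  assumes "1 / 2 \<le> \<rho>" "0 < \<kappa>" "\<kappa> \<le> real M" "0 < M"
  shows "(\<Sum>j<M. exp (- (\<kappa> * (1 - \<rho> * cos (2 * pi * real j / real M))))) / real M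
     \<le> 16 / sqrt \<kappa> * exp (- (\<kappa> * (1 - \<rho>)))"
proof -
  define u where "u = sqrt \<kappa> / real M"
  have u: "0 < u" using assms by (simp add: u_def)
  define g where "g i = exp 1 * exp (- (u * real i))" for i :: nat
  have gnn: "0 \<le> g i" for i by (simp add: g_def)
  have key: "exp (- (\<kappa> * (1 - \<rho> * cos (2 * pi * x / real M)))) \<le> exp (- (\<kappa> * (1 - \<rho>))) * (exp 1 * exp (- (u * x)))"
    if x: "0 \<le> x" "x \<le> real M / 2" for x
  proof -
    have h: "0 \<le> pi * x / real M" "pi * x / real M \<le> pi / 2"
      using x assms by (auto simp: field_simps)
    have "x / real M \<le> pi * x / real M / 2"
      using mult_right_mono[OF pi_ge_two x(1)] assms by (simp add: field_simps)
    also have "\<dots> \<le> sin (pi * x / real M)" by (rule sin_ge_half[OF h])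
    finally have s: "x / real M \<le> sin (pi * x / real M)" .
    have c: "1 - cos (2 * pi * x / real M) = 2 * (sin (pi * x / real M))\<^sup>2"
      using cos_double_sin[of "pi * x / real M"] by (simp add: mult.assoc)
    have "(u * x)\<^sup>2 = \<kappa> * (x / real M)\<^sup>2"
      using assms by (simp add: u_def power_mult_distrib power_divide)
    also have "\<dots> \<le> \<kappa> * (sin (pi * x / real M))\<^sup>2"
      using s x assms by (intro mult_left_mono power_mono) auto
    also have "\<dots> \<le> \<kappa> * (\<rho> * (2 * (sin (pi * x / real M))\<^sup>2))"
    proof -
      have "1 * (sin (pi * x / real M))\<^sup>2 \<le> (\<rho> * 2) * (sin (pi * x / real M))\<^sup>2"
        using assms by (intro mult_right_mono) auto
      then show ?thesis using assms by (intro mult_left_mono) auto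
    qed
    finally have a: "(u * x)\<^sup>2 \<le> \<kappa> * (\<rho> * (1 - cos (2 * pi * x / real M)))" by (simp only: c)
    \<comment> \<open>Replaces Gaussian decay by exponential decay at the cost of a factor e, so
      that a geometric series can be summed.\<close>
    have b: "u * x - 1 \<le> (u * x)\<^sup>2"
    proof -
      have "0 \<le> (u * x - 1)\<^sup>2 + u * x" using u x by simp
      moreover have "(u * x - 1)\<^sup>2 = (u * x)\<^sup>2 - 2 * (u * x) + 1"
        by (simp add: power2_eq_square algebra_simps)
      ultimately show ?thesis by linarith
    qed
    have "- (\<kappa> * (1 - \<rho> * cos (2 * pi * x / real M)))
        = - (\<kappa> * (1 - \<rho>)) - \<kappa> * (\<rho> * (1 - cos (2 * pi * x / real M)))"
      by (simp add: algebra_simps)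
    also have "\<dots> \<le> - (\<kappa> * (1 - \<rho>)) + (1 + - (u * x))" using a b by linarith
    finally show ?thesis by (simp flip: exp_add)
  qed
  \<comment> \<open>The cosine is symmetric under j -> M - j, so indices beyond M/2 are reflected
    into the range covered by \<open>key\<close>.\<close>
  have pt: "exp (- (\<kappa> * (1 - \<rho> * cos (2 * pi * real j / real M)))) \<le> exp (- (\<kappa> * (1 - \<rho>))) * (g j + g (M - j))"
    if "j < M" for j
  proof (cases "real j \<le> real M / 2")
    case True
    have "exp (- (\<kappa> * (1 - \<rho> * cos (2 * pi * real j / real M)))) \<le> exp (- (\<kappa> * (1 - \<rho>))) * g j"
      using key[of "real j"] True by (simp add: g_def)
    also have "\<dots> \<le> exp (- (\<kappa> * (1 - \<rho>))) * (g j + g (M - j))"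
      using gnn by (intro mult_left_mono) auto
    finally show ?thesis .
  next
    case False
    have "2 * pi * real (M - j) / real M = 2 * pi - 2 * pi * real j / real M"
      using that by (simp add: of_nat_diff field_simps)
    then have cs: "cos (2 * pi * real (M - j) / real M) = cos (2 * pi * real j / real M)"
      by (simp add: cos_diff)
    have "exp (- (\<kappa> * (1 - \<rho> * cos (2 * pi * real j / real M)))) \<le> exp (- (\<kappa> * (1 - \<rho>))) * g (M - j)"
      using key[of "real (M - j)"] False that unfolding cs g_def by (simp add: of_nat_diff)
    also have "\<dots> \<le> exp (- (\<kappa> * (1 - \<rho>))) * (g j + g (M - j))"
      using gnn by (intro mult_left_mono) auto
    finally show ?thesis .
  qed
  have "(\<Sum>j<M. g (M - j)) = (\<Sum>j<M. g (Suc j))"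
    using sum.nat_diff_reindex[of "\<lambda>i. g (Suc i)" M] by (simp add: Suc_diff_Suc)
  also have "\<dots> \<le> (\<Sum>j<M. g j)"
    using u by (intro sum_mono) (simp add: g_def)
  finally have "(\<Sum>j<M. g j + g (M - j)) \<le> 2 * (\<Sum>j<M. g j)" by (simp add: sum.distrib)
  also have "(\<Sum>j<M. g j) \<le> exp 1 * (1 + 1 / u)"
    unfolding g_def sum_distrib_left[symmetric] by (intro mult_left_mono sum_exp_neg_le u) simp
  also have "2 * (exp 1 * (1 + 1 / u)) \<le> 2 * (3 * (1 + 1 / u))"
    using u exp_le by (intro mult_left_mono mult_right_mono) auto
  finally have gs: "(\<Sum>j<M. g j + g (M - j)) \<le> 6 * (1 + 1 / u)" by simp
  have "(\<Sum>j<M. exp (- (\<kappa> * (1 - \<rho> * cos (2 * pi * real j / real M)))))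
      \<le> (\<Sum>j<M. exp (- (\<kappa> * (1 - \<rho>))) * (g j + g (M - j)))"
    using pt by (intro sum_mono) auto
  also have "\<dots> \<le> exp (- (\<kappa> * (1 - \<rho>))) * (6 * (1 + 1 / u))"
    unfolding sum_distrib_left[symmetric] by (intro mult_left_mono gs) simp
  finally have "(\<Sum>j<M. exp (- (\<kappa> * (1 - \<rho> * cos (2 * pi * real j / real M))))) / real M
      \<le> exp (- (\<kappa> * (1 - \<rho>))) * (6 * (1 + 1 / u)) / real M"
    using assms by (intro divide_right_mono) auto
  also have "\<dots> = exp (- (\<kappa> * (1 - \<rho>))) * (6 / real M + 6 / sqrt \<kappa>)"
    using assms by (simp add: u_def field_simps)
  also have "\<dots> \<le> exp (- (\<kappa> * (1 - \<rho>))) * (16 / sqrt \<kappa>)"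
  proof -
    have "1 \<le> real M" using assms by simp
    then have "sqrt (real M) * 1 \<le> sqrt (real M) * sqrt (real M)" by (intro mult_left_mono) auto
    then have "sqrt \<kappa> \<le> real M" using order_trans[OF real_sqrt_le_mono[OF assms(3)]] by simp
    then have "6 / real M \<le> 6 / sqrt \<kappa>" using assms by (intro divide_left_mono) auto
    then have "6 / real M + 6 / sqrt \<kappa> \<le> 12 / sqrt \<kappa>" by simp
    also have "\<dots> \<le> 16 / sqrt \<kappa>" using assms by (intro divide_right_mono) auto
    finally show ?thesis by (intro mult_left_mono) auto
  qed
  finally show ?thesis by (simp add: mult.commute)
qed

text \<open>Every summand of the average in \<open>norm_esym_le\<close> is at most exp(-\<kappa>/2),
  whatever the phase; the factor sqrt m from conditioning remains.\<close>

lemma norm_esym_le_small: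
  fixes \<zeta> :: "'a \<Rightarrow> complex"
  assumes "finite A" "card A = n" "0 < m" "m < n" "\<And>a. a \<in> A \<Longrightarrow> norm (\<zeta> a) = 1"
    and \<kappa>: "\<kappa> = real m * (1 - real m / real n)" and "cmod (\<Sum>a\<in>A. \<zeta> a) / real n \<le> 1 / 2"
  shows "norm (\<Sum>R | R \<subseteq> A \<and> card R = m. \<Prod>a\<in>R. \<zeta> a) / real (n choose m)
     \<le> 8 * sqrt (real m) * exp (- (\<kappa> / 2))"
proof -
  let ?\<rho> = "cmod (\<Sum>a\<in>A. \<zeta> a) / real n"
  have \<kappa>0: "0 \<le> \<kappa>" using assms by simp
  have "exp (- (\<kappa> * (1 - ?\<rho> * cos y))) \<le> exp (- (\<kappa> / 2))" for y
  proof -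
    have "?\<rho> * cos y \<le> ?\<rho> * 1" by (intro mult_left_mono) auto
    then have "1 / 2 \<le> 1 - ?\<rho> * cos y" using assms(7) by linarith
    then have "\<kappa> * (1 / 2) \<le> \<kappa> * (1 - ?\<rho> * cos y)" using \<kappa>0 by (rule mult_left_mono)
    then show ?thesis by simp
  qed
  then have "(\<Sum>j<Suc n. exp (- (\<kappa> * (1 - ?\<rho> * cos (2 * pi * real j / real (Suc n))))))
      \<le> (\<Sum>j<Suc n. exp (- (\<kappa> / 2)))"
    by (intro sum_mono) blast
  then have "(\<Sum>j<Suc n. exp (- (\<kappa> * (1 - ?\<rho> * cos (2 * pi * real j / real (Suc n)))))) / real (Suc n)
      \<le> exp (- (\<kappa> / 2))"
    by (simp add: field_simps del: sum.lessThan_Suc)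
  then show ?thesis
    by (intro order_trans[OF norm_esym_le[OF assms(1-5) refl \<kappa>]] mult_left_mono) auto
qed

text \<open>Here averaging over the phase gains 1 / sqrt \<kappa>, which offsets the factor sqrt m
  lost by conditioning.\<close>

lemma norm_esym_le_large:
  fixes \<zeta> :: "'a \<Rightarrow> complex"
  assumes "finite A" "card A = n" "0 < m" "m < n" "\<And>a. a \<in> A \<Longrightarrow> norm (\<zeta> a) = 1"
    and \<kappa>: "\<kappa> = real m * (1 - real m / real n)" and "1 / 2 \<le> cmod (\<Sum>a\<in>A. \<zeta> a) / real n"
  shows "norm (\<Sum>R | R \<subseteq> A \<and> card R = m. \<Prod>a\<in>R. \<zeta> a) / real (n choose m)
     \<le> 128 * sqrt (real m / \<kappa>) * exp (- (\<kappa> * (1 - cmod (\<Sum>a\<in>A. \<zeta> a) / real n)))"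
proof -
  have "0 < \<kappa>" using assms by simp
  have "\<kappa> \<le> real m * 1" unfolding \<kappa> by (intro mult_left_mono) auto
  then have "\<kappa> \<le> real (Suc n)" using assms(4) by linarith
  have "norm (\<Sum>R | R \<subseteq> A \<and> card R = m. \<Prod>a\<in>R. \<zeta> a) / real (n choose m)
     \<le> 8 * sqrt (real m) * (16 / sqrt \<kappa> * exp (- (\<kappa> * (1 - cmod (\<Sum>a\<in>A. \<zeta> a) / real n))))"
    by (intro order_trans[OF norm_esym_le[OF assms(1-5) refl \<kappa>]] mult_left_mono
          average_exp_cos_le assms) (use \<open>0 < \<kappa>\<close> \<open>\<kappa> \<le> real (Suc n)\<close> in auto)
  then show ?thesis by (simp add: real_sqrt_divide)
qed

subsection \<open>Growth of balls in a cyclic group\<close>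

text \<open>A subgroup of the integers consists of the multiples of its least positive element d. As
  q is one of them, d divides q; unless d = 1, any prime factor of d serves as p.\<close>

lemma int_subgroup_trivial_or_prime:
  fixes H :: "int set" and q :: nat
  assumes "int q \<in> H" "0 < q" and diff: "\<And>x y. x \<in> H \<Longrightarrow> y \<in> H \<Longrightarrow> x - y \<in> H"
  shows "H = UNIV \<or> (\<exists>p. prime p \<and> p dvd q \<and> (\<forall>x\<in>H. int p dvd x))"
proof -
  have zero: "0 \<in> H" using diff[OF assms(1) assms(1)] by simp
  have neg: "- x \<in> H" if "x \<in> H" for x using diff[OF zero that] by simp
  have add: "x + y \<in> H" if "x \<in> H" "y \<in> H" for x y using diff[OF that(1) neg[OF that(2)]] by simp
  have nmult: "int k * x \<in> H" if "x \<in> H" for k x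
    by (induction k) (auto simp: zero add that distrib_right)
  have mult: "k * x \<in> H" if "x \<in> H" for k x
    using nmult[OF that, of "nat k"] nmult[OF neg[OF that], of "nat (- k)"] by (cases "0 \<le> k") auto
  define d where "d = (LEAST d. 0 < d \<and> int d \<in> H)"
  have d: "0 < d" "int d \<in> H"
    using LeastI_ex[of "\<lambda>d. 0 < d \<and> int d \<in> H"] assms unfolding d_def by auto
  have dvd: "int d dvd x" if "x \<in> H" for x
  proof -
    have "x mod int d = x - (x div int d) * int d" by (simp add: minus_div_mult_eq_mod)
    then have "x mod int d \<in> H" using diff[OF that mult[OF d(2)]] by simp
    moreover have "0 \<le> x mod int d" "x mod int d < int d" using d by auto
    ultimately have "\<not> 0 < nat (x mod int d)"
      using not_less_Least[of "nat (x mod int d)" "\<lambda>d. 0 < d \<and> int d \<in> H"] unfolding d_def[symmetric]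
      by auto
    then have "x mod int d = 0" using \<open>0 \<le> x mod int d\<close> by simp
    then show ?thesis by auto
  qed
  show ?thesis
  proof (cases "d = 1")
    case True
    then have "x \<in> H" for x using mult[OF d(2), of x] by simp
    then show ?thesis by blast
  next
    case False
    then obtain p where p: "prime p" "p dvd d" using prime_factor_nat by blast
    have "p dvd q" using p(2) dvd[OF assms(1)] by (metis dvd_trans int_dvd_int_iff)
    moreover have "int p dvd x" if "x \<in> H" for x
      using dvd[OF that] p(2) by (metis dvd_trans int_dvd_int_iff)
    ultimately show ?thesis using p by blast
  qed
qed

lemma card_multiples_le:
  fixes p q :: nat
  assumes "0 < p" "p dvd q"
  shows "real (card {x \<in> {0..<int q}. int p dvd x}) \<le> real q / real p"
proof -
  have "{x \<in> {0..<int q}. int p dvd x} \<subseteq> (\<lambda>i. int p * int i) ` {..<q div p}"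
  proof
    fix x assume x: "x \<in> {x \<in> {0..<int q}. int p dvd x}"
    then obtain y where y: "x = int p * y" by blast
    from assms obtain k where k: "q = p * k" by blast
    have "0 \<le> y" "y < int k" using x assms(1) unfolding y k by (auto simp: zero_le_mult_iff)
    then show "x \<in> (\<lambda>i. int p * int i) ` {..<q div p}"
      using assms(1) unfolding y k by (intro image_eqI[of _ _ "nat y"]) auto
  qed
  then have "card {x \<in> {0..<int q}. int p dvd x} \<le> card {..<q div p}"
    by (rule surj_card_le[rotated]) simp
  then show ?thesis using assms by (metis card_lessThan of_nat_le_iff real_of_nat_div)
qed

text \<open>\<open>\<delta>\<close> is an invariant pseudometric on the cyclic group of order \<open>q\<close>, seen from the origin.\<close>

locale cyclic_seminorm =
  fixes q :: nat and \<delta> :: "int \<Rightarrow> real"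
  assumes q_pos: "0 < q"
    and zero: "\<delta> 0 = 0"
    and triangle: "\<delta> (x + y) \<le> \<delta> x + \<delta> y"
    and minus: "\<delta> (- x) = \<delta> x"
    and periodic: "\<delta> (x + int q * k) = \<delta> x"
begin

definition cball :: "real \<Rightarrow> int set" where
  "cball s = {x \<in> {0..<int q}. \<delta> x \<le> s}"

lemma finite_cball: "finite (cball s)"
  unfolding cball_def by (rule finite_subset[of _ "{0..<int q}"]) auto

lemma mod_eq: "\<delta> (x mod int q) = \<delta> x"
  using periodic[of x "- (x div int q)"] by (simp add: minus_mult_div_eq_mod)

lemma cong_eq: "[x = y] (mod int q) \<Longrightarrow> \<delta> x = \<delta> y"
  by (metis mod_eq cong_def)

text \<open>If the shell \<open>(u - s, u]\<close> is empty, the ball of radius \<open>u - s\<close> is stable under adding elements of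
  the ball of radius \<open>s\<close>, which therefore lies in the stabiliser, a subgroup contained in the former.\<close>

lemma gap:
  assumes "0 \<le> u - s" "\<And>x. \<not> (u - s < \<delta> x \<and> \<delta> x \<le> u)"
  shows "(\<forall>x. \<delta> x \<le> u - s) \<or> (\<exists>p. prime p \<and> p dvd q \<and> (\<forall>x. \<delta> x \<le> s \<longrightarrow> int p dvd x))"
proof -
  define B where "B = {x. \<delta> x \<le> u - s}"
  define H where "H = {h. \<forall>x. x \<in> B \<longleftrightarrow> x + h \<in> B}"
  have zB: "0 \<in> B" using assms by (simp add: B_def zero)
  \<comment> \<open>The triangle inequality alone gives \<delta> (x + h) <= u; the empty shell
    improves this to u - s.\<close>
  have add: "x + h \<in> B" if "x \<in> B" "\<delta> h \<le> s" for x h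
    using triangle[of x h] that assms(2)[of "x + h"] by (auto simp: B_def)
  have BH: "h \<in> H" if "\<delta> h \<le> s" for h
    unfolding H_def using add[OF _ that] add[of _ "- h"] that by (auto simp: minus) (metis add_diff_cancel)
  have HB: "H \<subseteq> B"
  proof
    fix h assume "h \<in> H"
    then have "0 \<in> B \<longleftrightarrow> 0 + h \<in> B" unfolding H_def by blast
    then show "h \<in> B" using zB by simp
  qed
  have "int q \<in> H" using periodic[of _ 1] by (auto simp: H_def B_def)
  moreover have "x - y \<in> H" if "x \<in> H" "y \<in> H" for x y
  proof -
    have "z \<in> B \<longleftrightarrow> z + (x - y) \<in> B" for z
    proof -
      have "z \<in> B \<longleftrightarrow> z + x \<in> B" using that(1) by (simp add: H_def)
      also have "\<dots> \<longleftrightarrow> z + (x - y) \<in> B"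
      proof -
        have "z + (x - y) \<in> B \<longleftrightarrow> z + (x - y) + y \<in> B" using that(2) unfolding H_def by blast
        then show ?thesis by simp
      qed
      finally show ?thesis .
    qed
    then show ?thesis by (simp add: H_def)
  qed
  ultimately have "H = UNIV \<or> (\<exists>p. prime p \<and> p dvd q \<and> (\<forall>x\<in>H. int p dvd x))"
    using q_pos by (intro int_subgroup_trivial_or_prime) auto
  then show ?thesis using BH HB by (auto simp: B_def)
qed

text \<open>Points chosen in the shells \<open>(3is - s, 3is]\<close> are pairwise more than \<open>2s\<close> apart.\<close>

lemma packing:
  assumes "0 < s" and shell: "\<And>i. i \<le> J \<Longrightarrow> \<exists>x. 3 * real i * s - s < \<delta> x \<and> \<delta> x \<le> 3 * real i * s"
    and "(3 * real J + 1) * s \<le> s0"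
  shows "(J + 1) * card (cball s) \<le> card (cball s0)"
proof -
  obtain x where x: "3 * real i * s - s < \<delta> (x i)" "\<delta> (x i) \<le> 3 * real i * s" if "i \<le> J" for i
    using shell by metis
  \<comment> \<open>Puts a translate of the small ball at each of the J+1 centres. If the translates
    at i > j met, \<delta> (x i) would be at most 3js + 2s <= 3is - s, contrary to the choice of
    \<open>x i\<close>.\<close>
  define f where "f = (\<lambda>(i, y). (x i + y) mod int q)"
  have ne: False if ij: "i \<le> J" "j < i" and y: "\<delta> y \<le> s" "\<delta> y' \<le> s"
    and eq: "(x i + y) mod int q = (x j + y') mod int q" for i j y y'
  proof -
    have "[x i + y = x j + y'] (mod int q)" using eq by (simp add: cong_def)
    then have "[x i = x j + y' + - y] (mod int q)"
      by (simp add: cong_iff_dvd_diff algebra_simps)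
    then have "\<delta> (x i) = \<delta> (x j + y' + - y)" by (rule cong_eq)
    also have "\<dots> \<le> \<delta> (x j) + \<delta> y' + \<delta> y"
      using triangle[of "x j + y'" "- y"] triangle[of "x j" y'] minus[of y] by simp
    also have "\<dots> \<le> 3 * real j * s + s + s" using x(2)[of j] ij y by auto
    also have "\<dots> = 3 * (real j + 1) * s - s" by (simp add: algebra_simps)
    also have "\<dots> \<le> 3 * real i * s - s" using ij assms(1) by simp
    also have "\<dots> < \<delta> (x i)" using x(1) ij by simp
    finally show False by simp
  qed
  have inj: "inj_on f ({0..J} \<times> cball s)"
  proof (rule inj_onI)
    fix a b assume ab: "a \<in> {0..J} \<times> cball s" "b \<in> {0..J} \<times> cball s" "f a = f b"
    obtain i y where a: "a = (i, y)" by force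
    obtain j y' where b: "b = (j, y')" by force
    have "i = j"
    proof (rule ccontr)
      assume "i \<noteq> j"
      then consider "j < i" | "i < j" by linarith
      then show False
        using ne[of i j y y'] ne[of j i y' y] ab by cases (auto simp: a b f_def cball_def)
    qed
    then have "[x i + y = x i + y'] (mod int q)" using ab by (simp add: a b f_def cong_def)
    then have "[y = y'] (mod int q)" by (simp add: cong_add_lcancel)
    then have "y = y'" using ab by (auto simp: a b cball_def cong_def)
    then show "a = b" using \<open>i = j\<close> by (simp add: a b)
  qed
  have "f ` ({0..J} \<times> cball s) \<subseteq> cball s0"
  proof safe
    fix i y assume iy: "i \<in> {0..J}" "y \<in> cball s"
    have "\<delta> ((x i + y) mod int q) = \<delta> (x i + y)" by (rule mod_eq)
    also have "\<dots> \<le> 3 * real i * s + s"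
      using triangle[of "x i" y] x(2)[of i] iy by (auto simp: cball_def)
    also have "\<dots> \<le> 3 * real J * s + s" using iy assms(1) by simp
    also have "\<dots> \<le> s0" using assms(3) by (simp add: algebra_simps)
    finally show "f (i, y) \<in> cball s0" using q_pos by (simp add: f_def cball_def)
  qed
  then have "card ({0..J} \<times> cball s) \<le> card (cball s0)"
    by (rule card_inj_on_le[OF inj _ finite_cball])
  then show ?thesis by (simp add: card_cartesian_product)
qed

text \<open>Either every shell needed for the packing contains a point, and about s0/s disjoint
  translates of the small ball fit into the large one; or some shell is empty, and
  \<open>gap\<close> confines the small ball to the multiples of a prime divisor of q. The other
  outcome of \<open>gap\<close> is excluded by \<open>notall\<close>.\<close>

lemma card_cball_growth:
  assumes "0 < s" "0 < s0" and notall: "\<not> (\<forall>x. \<delta> x \<le> s0)"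
    and \<mu>: "0 < \<mu>" "\<And>p. prime p \<Longrightarrow> p dvd q \<Longrightarrow> \<mu> \<le> real p"
  shows "real (card (cball (min s s0))) \<le> 6 * (s / s0) * real (card (cball s0)) + real q / \<mu>"
proof (cases "s \<le> s0")
  case False
  then have "1 \<le> s / s0" using assms by simp
  then have "1 * real (card (cball s0)) \<le> 6 * (s / s0) * real (card (cball s0))"
    by (intro mult_right_mono) auto
  then show ?thesis using False \<mu>(1) by simp (smt (verit) divide_nonneg_pos of_nat_0_le_iff)
next
  case True
  \<comment> \<open>The largest J with (3J + 1)s <= s0, as \<open>packing\<close> requires.\<close>
  define J where "J = nat \<lfloor>(s0 / s - 1) / 3\<rfloor>"
  have r1: "1 \<le> s0 / s" using True assms by simp
  have J: "real J \<le> (s0 / s - 1) / 3" "(s0 / s - 1) / 3 < real J + 1"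
  proof -
    have "0 \<le> (s0 / s - 1) / 3" using r1 by simp
    then have "real J = of_int \<lfloor>(s0 / s - 1) / 3\<rfloor>" by (simp add: J_def)
    then show "real J \<le> (s0 / s - 1) / 3" "(s0 / s - 1) / 3 < real J + 1" by linarith+
  qed
  have "3 * real J + 1 \<le> s0 / s" using J(1) by simp
  then have Js: "(3 * real J + 1) * s \<le> s0" using assms by (simp add: field_simps)
  show ?thesis
  proof (cases "\<forall>i\<le>J. \<exists>x. 3 * real i * s - s < \<delta> x \<and> \<delta> x \<le> 3 * real i * s")
    case shells: True
    have "(J + 1) * card (cball s) \<le> card (cball s0)"
      using shells by (intro packing[OF assms(1) _ Js]) auto
    then have "real ((J + 1) * card (cball s)) \<le> real (card (cball s0))" by (rule of_nat_mono)
    then have pk: "(real J + 1) * real (card (cball s)) \<le> real (card (cball s0))"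
      by (simp only: of_nat_mult of_nat_add of_nat_1)
    \<comment> \<open>For r = s0/s >= 2 one has (r-1)/3 >= r/6, and for r <= 2 already r/6 < 1. This
      is the origin of the factor 6.\<close>
    have "s0 / s / 6 \<le> real J + 1" using J(2) by (cases "s0 / s \<le> 2") auto
    then have "s0 / s / 6 * real (card (cball s)) \<le> (real J + 1) * real (card (cball s))"
      by (intro mult_right_mono) auto
    then have "s0 / s / 6 * real (card (cball s)) \<le> real (card (cball s0))" using pk by linarith
    then have "real (card (cball s)) \<le> 6 * (s / s0) * real (card (cball s0))"
      using assms(1,2) by (simp add: field_simps)
    moreover have "0 \<le> real q / \<mu>" using \<mu> by simp
    ultimately show ?thesis using True by (simp add: min_absorb1)
  next
    case False
    then obtain i where i: "i \<le> J" "\<And>x. \<not> (3 * real i * s - s < \<delta> x \<and> \<delta> x \<le> 3 * real i * s)"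
      by blast
    \<comment> \<open>The shell (-s, 0] contains the origin, so an empty shell has i >= 1 and its
      lower end is nonnegative, as \<open>gap\<close> demands.\<close>
    have "i \<noteq> 0" using i(2)[of 0] assms(1) by (auto simp: zero)
    then have "1 \<le> real i" by simp
    then have "s * 1 \<le> s * (3 * real i)" using assms(1) by (intro mult_left_mono) auto
    then have u: "0 \<le> 3 * real i * s - s" by (simp add: mult_ac)
    have "3 * real i * s \<le> 3 * real J * s" using i(1) assms(1) by simp
    also have "\<dots> \<le> s0" using Js assms(1) by (simp add: algebra_simps)
    finally have "3 * real i * s - s \<le> s0" using assms(1) by simp
    then have "\<not> (\<forall>x. \<delta> x \<le> 3 * real i * s - s)" using notall order_trans by blast
    then obtain p where p: "prime p" "p dvd q" "\<And>x. \<delta> x \<le> s \<Longrightarrow> int p dvd x"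
      using gap[OF u i(2)] by blast
    have p0: "0 < p" using p(1) by (rule prime_gt_0_nat)
    have "card (cball s) \<le> card {x \<in> {0..<int q}. int p dvd x}"
      using p(3) by (intro card_mono[OF finite_subset[of _ "{0..<int q}"]]) (auto simp: cball_def)
    then have "real (card (cball s)) \<le> real (card {x \<in> {0..<int q}. int p dvd x})" by simp
    also have "\<dots> \<le> real q / real p" by (rule card_multiples_le[OF p0 p(2)])
    also have "\<dots> \<le> real q / \<mu>"
      using \<mu>(2)[OF p(1,2)] \<mu>(1) by (intro divide_left_mono) auto
    finally show ?thesis using True assms by (simp add: min_absorb1 add_increasing)
  qed
qed

end

subsection \<open>Trigonometric sums and subset sums\<close>

lemma sum_cis_orthogonality_int:
  fixes q :: nat and k :: int
  assumes "0 < q"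
  shows "(\<Sum>r\<in>{0..<int q}. cis (2 * pi * real_of_int r * real_of_int k / real q))
    = (if int q dvd k then of_nat q else 0)"
proof -
  have "{0..<int q} = int ` {..<q}"
    using image_int_atLeastLessThan[of 0 q] by (simp add: lessThan_atLeast0)
  then have "(\<Sum>r\<in>{0..<int q}. cis (2 * pi * real_of_int r * real_of_int k / real q))
      = (\<Sum>r<q. cis (2 * pi * real r * real_of_int k / real q))"
    by (simp add: sum.reindex)
  then show ?thesis using sum_cis_orthogonality[OF assms] by simp
qed

lemma prod_cis: "finite A \<Longrightarrow> (\<Prod>a\<in>A. cis (f a)) = cis (\<Sum>a\<in>A. f a)"
proof (induction A rule: finite_induct)
  case (insert a A)
  then show ?case by (simp only: prod.insert sum.insert cis_mult not_False_eq_True)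
qed simp

definition trig_sum :: "nat \<Rightarrow> int set \<Rightarrow> int \<Rightarrow> complex" where
  "trig_sum q A r = (\<Sum>a\<in>A. cis (2 * pi * real_of_int r * real_of_int a / real q))"

text \<open>Up to normalisation, the \<open>L\<^sup>2\<close> distance between 1 and the character \<open>r\<close> on the differences of \<open>A\<close>;
  being an \<open>L\<^sup>2\<close> norm makes it subadditive in \<open>r\<close>.\<close>

definition trig_dist :: "nat \<Rightarrow> int set \<Rightarrow> int \<Rightarrow> real" where
  "trig_dist q A r =
     L2_set (\<lambda>(a, b). sin (pi * real_of_int r * real_of_int (a - b) / real q)) (A \<times> A) / real (card A)"

lemma norm_trig_sum_power2:
  "(cmod (trig_sum q A r))\<^sup>2
     = (\<Sum>(a, b)\<in>A \<times> A. cos (2 * pi * real_of_int r * real_of_int (a - b) / real q))"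
proof -
  let ?x = "\<lambda>a. 2 * pi * real_of_int r * real_of_int a / real q"
  have "(cmod (trig_sum q A r))\<^sup>2 = (\<Sum>a\<in>A. cos (?x a))\<^sup>2 + (\<Sum>a\<in>A. sin (?x a))\<^sup>2"
    by (simp add: trig_sum_def cmod_power2)
  also have "\<dots> = (\<Sum>a\<in>A. \<Sum>b\<in>A. cos (?x a) * cos (?x b) + sin (?x a) * sin (?x b))"
    by (simp add: power2_eq_square sum_product sum.distrib)
  also have "\<dots> = (\<Sum>a\<in>A. \<Sum>b\<in>A. cos (?x (a - b)))"
    by (intro sum.cong refl) (simp add: cos_diff[symmetric] right_diff_distrib diff_divide_distrib)
  finally show ?thesis by (simp add: sum.cartesian_product)
qed

lemma trig_dist_power2:
  "(trig_dist q A r)\<^sup>2 * (real (card A))\<^sup>2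
     = (\<Sum>(a, b)\<in>A \<times> A. (sin (pi * real_of_int r * real_of_int (a - b) / real q))\<^sup>2)"
proof (cases "card A = 0")
  \<comment> \<open>Here \<open>A\<close> is empty or infinite; in the infinite case the sum over
    \<open>A \<times> A\<close> is 0 by convention.\<close>
  case True
  then show ?thesis by (auto simp: card_eq_0_iff finite_cartesian_product_iff intro!: sum.infinite)
next
  case False
  then show ?thesis
    unfolding trig_dist_def L2_set_def power_divide
    by (simp add: sum_nonneg case_prod_unfold)
qed

text \<open>The identity cos 2y = 1 - 2 sin^2 y, applied to each pair of elements, turns a large
  trigonometric sum into a small distance.\<close>

lemma norm_trig_sum_eq_trig_dist:
  assumes "finite A"
  shows "(cmod (trig_sum q A r))\<^sup>2 = (real (card A))\<^sup>2 * (1 - 2 * (trig_dist q A r)\<^sup>2)"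
proof -
  have "(cmod (trig_sum q A r))\<^sup>2
      = (\<Sum>(a, b)\<in>A \<times> A. 1 - 2 * (sin (pi * real_of_int r * real_of_int (a - b) / real q))\<^sup>2)"
    unfolding norm_trig_sum_power2
  proof (intro sum.cong refl, clarify)
    fix a b
    show "cos (2 * pi * real_of_int r * real_of_int (a - b) / real q)
        = 1 - 2 * (sin (pi * real_of_int r * real_of_int (a - b) / real q))\<^sup>2"
      using cos_double_sin[of "pi * real_of_int r * real_of_int (a - b) / real q"] by (simp add: mult.assoc)
  qed
  also have "\<dots> = real (card (A \<times> A)) - 2 * ((trig_dist q A r)\<^sup>2 * (real (card A))\<^sup>2)"
    unfolding trig_dist_power2 by (simp add: case_prod_unfold sum_subtractf sum_distrib_left)
  finally show ?thesis by (simp add: card_cartesian_product power2_eq_square algebra_simps)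
qed

text \<open>Subadditivity follows from |sin(u+v)| <= |sin u| + |sin v| for each pair and Minkowski's
  inequality.\<close>

lemma trig_dist_cyclic_seminorm:
  assumes "0 < q"
  shows "cyclic_seminorm q (trig_dist q A)"
proof
  show "0 < q" by fact
  show "trig_dist q A 0 = 0"
    by (simp add: trig_dist_def L2_set_def case_prod_unfold)
  show "trig_dist q A (- x) = trig_dist q A x" for x
    by (simp add: trig_dist_def L2_set_def case_prod_unfold)
  show "trig_dist q A (x + int q * k) = trig_dist q A x" for x k
  proof -
    \<comment> \<open>The shift moves the argument by an integer multiple of pi, which can only
      change the sign of the sine; hence the squares.\<close>
    have "(sin (pi * real_of_int (x + int q * k) * real_of_int d / real q))\<^sup>2
        = (sin (pi * real_of_int x * real_of_int d / real q))\<^sup>2" for d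
    proof -
      have "pi * real_of_int (x + int q * k) * real_of_int d / real q
          = pi * real_of_int x * real_of_int d / real q + of_int (k * d) * pi"
        using assms by (simp add: field_simps)
      moreover have "sin (of_int (k * d) * pi) = 0" by (auto simp: sin_zero_iff_int2 intro!: exI[of _ "k * d"])
      moreover from this have "(cos (of_int (k * d) * pi))\<^sup>2 = 1"
        using sin_cos_squared_add[of "of_int (k * d) * pi"] by simp
      ultimately show ?thesis by (simp add: sin_add power_mult_distrib)
    qed
    then show ?thesis by (simp only: trig_dist_def L2_set_def case_prod_unfold)
  qed
  show "trig_dist q A (x + y) \<le> trig_dist q A x + trig_dist q A y" for x y
  proof -
    let ?s = "\<lambda>x (a, b). sin (pi * real_of_int x * real_of_int (a - b) / real q)"
    have abs: "L2_set (\<lambda>i. \<bar>f i\<bar>) S = L2_set f S" for f :: "int \<times> int \<Rightarrow> real" and S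
      by (simp add: L2_set_def)
    have "L2_set (?s (x + y)) (A \<times> A) = L2_set (\<lambda>i. \<bar>?s (x + y) i\<bar>) (A \<times> A)" by (simp add: abs)
    also have "\<dots> \<le> L2_set (\<lambda>i. \<bar>?s x i\<bar> + \<bar>?s y i\<bar>) (A \<times> A)"
    proof (intro L2_set_mono)
      fix i assume "i \<in> A \<times> A"
      obtain a b where i: "i = (a, b)" by force
      let ?u = "pi * real_of_int x * real_of_int (a - b) / real q"
      let ?v = "pi * real_of_int y * real_of_int (a - b) / real q"
      have "pi * real_of_int (x + y) * real_of_int (a - b) / real q = ?u + ?v"
        by (simp add: distrib_left distrib_right add_divide_distrib)
      moreover have "\<bar>sin (?u + ?v)\<bar> \<le> \<bar>sin ?u\<bar> + \<bar>sin ?v\<bar>"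
      proof -
        have "\<bar>sin (?u + ?v)\<bar> \<le> \<bar>sin ?u\<bar> * \<bar>cos ?v\<bar> + \<bar>cos ?u\<bar> * \<bar>sin ?v\<bar>"
          unfolding sin_add by (simp flip: abs_mult)
        also have "\<dots> \<le> \<bar>sin ?u\<bar> * 1 + 1 * \<bar>sin ?v\<bar>"
          by (intro add_mono mult_left_mono mult_right_mono) auto
        finally show ?thesis by simp
      qed
      ultimately show "\<bar>?s (x + y) i\<bar> \<le> \<bar>?s x i\<bar> + \<bar>?s y i\<bar>" by (simp only: i case_prod_conv)
    qed auto
    also have "\<dots> \<le> L2_set (\<lambda>i. \<bar>?s x i\<bar>) (A \<times> A) + L2_set (\<lambda>i. \<bar>?s y i\<bar>) (A \<times> A)"
      by (rule L2_set_triangle_ineq)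
    finally have "L2_set (?s (x + y)) (A \<times> A) \<le> L2_set (?s x) (A \<times> A) + L2_set (?s y) (A \<times> A)"
      by (simp add: abs)
    then show ?thesis
      unfolding trig_dist_def add_divide_distrib[symmetric] by (rule divide_right_mono) simp
  qed
qed

text \<open>Members of one residue class modulo q are told apart by their quotient by q, which takes
  at most t values.\<close>

lemma card_residue_class_le:
  assumes "0 < q" "A \<subseteq> {0..<int (t * q)}"
  shows "card {b \<in> A. int q dvd a - b} \<le> t"
proof -
  let ?S = "{b \<in> A. int q dvd a - b}"
  have "card ?S \<le> card {0..<int t}"
  proof (rule card_inj_on_le)
    show "inj_on (\<lambda>b. b div int q) ?S"
    proof (rule inj_onI)
      fix b c assume bc: "b \<in> ?S" "c \<in> ?S" "b div int q = c div int q"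
      have "int q dvd (a - c) - (a - b)" using dvd_diff[of "int q" "a - c" "a - b"] bc by simp
      then have "b mod int q = c mod int q" by (simp add: mod_eq_dvd_iff)
      then show "b = c" using bc(3) by (metis div_mult_mod_eq)
    qed
    show "(\<lambda>b. b div int q) ` ?S \<subseteq> {0..<int t}"
    proof safe
      fix b assume "b \<in> A"
      then have b: "0 \<le> b" "b < int t * int q" using assms by auto
      have "b div int q < int t"
      proof (rule ccontr)
        assume "\<not> b div int q < int t"
        then have "int t * int q \<le> b div int q * int q" by (intro mult_right_mono) auto
        also have "\<dots> \<le> b" using assms(1) by (simp flip: minus_mod_eq_div_mult)
        finally show False using b by simp
      qed
      then show "b div int q \<in> {0..<int t}"
        using assms(1) b by (simp add: pos_imp_zdiv_nonneg_iff)
    qed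
  qed simp
  then show ?thesis by simp
qed

text \<open>Parseval: the left side is q times the number of pairs in \<open>A\<close> congruent
  modulo q, and each element has at most t partners.\<close>

lemma sum_norm_trig_sum_power2_le:
  assumes "0 < q" "A \<subseteq> {0..<int (t * q)}"
  shows "(\<Sum>r\<in>{0..<int q}. (cmod (trig_sum q A r))\<^sup>2) \<le> real q * real (card A) * real t"
proof -
  have fin: "finite A" using assms(2) finite_subset by blast
  have "(\<Sum>r\<in>{0..<int q}. (cmod (trig_sum q A r))\<^sup>2)
      = (\<Sum>i\<in>A \<times> A. \<Sum>r\<in>{0..<int q}. case i of (a, b) \<Rightarrow> cos (2 * pi * real_of_int r * real_of_int (a - b) / real q))"
    unfolding norm_trig_sum_power2 by (rule sum.swap)
  also have "\<dots> = (\<Sum>(a, b)\<in>A \<times> A. if int q dvd a - b then real q else 0)"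
  proof (intro sum.cong refl, clarify)
    fix a b
    have "(\<Sum>r\<in>{0..<int q}. cos (2 * pi * real_of_int r * real_of_int (a - b) / real q))
       = Re (\<Sum>r\<in>{0..<int q}. cis (2 * pi * real_of_int r * real_of_int (a - b) / real q))"
      by simp
    also have "\<dots> = (if int q dvd a - b then real q else 0)"
      unfolding sum_cis_orthogonality_int[OF assms(1)] by simp
    finally show "(\<Sum>r\<in>{0..<int q}. cos (2 * pi * real_of_int r * real_of_int (a - b) / real q))
       = (if int q dvd a - b then real q else 0)" .
  qed
  also have "\<dots> = (\<Sum>a\<in>A. \<Sum>b\<in>A. if int q dvd a - b then real q else 0)"
    by (simp add: sum.cartesian_product)
  also have "\<dots> = (\<Sum>a\<in>A. real q * real (card {b \<in> A. int q dvd a - b}))"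
    using fin by (intro sum.cong refl) (simp flip: sum.inter_filter)
  also have "\<dots> \<le> (\<Sum>a\<in>A. real q * real t)"
    using card_residue_class_le[OF assms] by (intro sum_mono mult_left_mono) auto
  finally show ?thesis by (simp add: mult_ac)
qed

section \<open>Trivial and Fourier bounds for the probability\<close>

lemma prob_random_subset:
  assumes "finite A" "m \<le> card A"
  shows "measure_pmf.prob (random_subset m A) {R. P R}
    = real (card {R. R \<subseteq> A \<and> card R = m \<and> P R}) / real (card A choose m)"
proof -
  let ?S = "{R. R \<subseteq> A \<and> card R = m}"
  have S: "finite ?S" "card ?S = card A choose m"
    using assms by (auto simp: n_subsets)
  have "0 < card ?S" using S assms by simp
  then have "?S \<noteq> {}" using card_gt_0_iff by blast
  then show ?thesis
    using S unfolding random_subset_def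
    by (subst measure_pmf_of_set) (auto intro!: arg_cong[of _ _ card] simp: Collect_conj_eq Int_assoc)
qed

text \<open>Double counting: remove one element x from a subset R with the prescribed sum. The
  remaining m-1 elements determine x modulo N, hence x and R, so m times the number of such R is at
  most the number of (m-1)-subsets.\<close>

lemma prob_subset_sum_le_trivial:
  assumes "A \<subseteq> {0..<int N}" "card A = n" "1 \<le> m" "m \<le> n"
  shows "measure_pmf.prob (random_subset m A) {R. [subset_sum R = z] (mod int N)} \<le> 1 / (real n - real m + 1)"
proof -
  have fin: "finite A" using assms(1) finite_subset by blast
  let ?G = "{R. R \<subseteq> A \<and> card R = m \<and> [subset_sum R = z] (mod int N)}"
  let ?H = "{R. R \<subseteq> A \<and> card R = m - 1}"
  have finR: "finite R" if "R \<in> ?G" for R using that fin finite_subset by auto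
  have "card (SIGMA R:?G. R) \<le> card ?H"
  proof (rule card_inj_on_le)
    show "finite ?H" using fin by simp
    show "(\<lambda>(R, x). R - {x}) ` (SIGMA R:?G. R) \<subseteq> ?H"
    proof clarify
      fix R x assume "R \<subseteq> A" "x \<in> R"
      then show "R - {x} \<subseteq> A \<and> card (R - {x}) = card R - 1"
        using finite_subset[OF \<open>R \<subseteq> A\<close> fin] by (auto simp: card_Diff_singleton)
    qed
    show "inj_on (\<lambda>(R, x). R - {x}) (SIGMA R:?G. R)"
    proof (rule inj_onI, clarify)
      fix R x R' x'
      assume R: "R \<subseteq> A" "m = card R" "[subset_sum R = z] (mod int N)" "x \<in> R"
        and R': "R' \<subseteq> A" "card R' = card R" "[subset_sum R' = z] (mod int N)" "x' \<in> R'"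
        and eq: "R - {x} = R' - {x'}"
      have f: "finite R" "finite R'" using R R' fin finite_subset by auto
      have "subset_sum R = x + subset_sum (R - {x})" "subset_sum R' = x' + subset_sum (R' - {x'})"
        unfolding subset_sum_def using f R R' by (auto simp: sum.remove)
      then have "[x + subset_sum (R - {x}) = x' + subset_sum (R - {x})] (mod int N)"
        using cong_trans[OF R(3) cong_sym[OF R'(3)]] by (simp only: eq)
      then have "[x = x'] (mod int N)" by (simp add: cong_add_rcancel)
      moreover have "x \<in> {0..<int N}" "x' \<in> {0..<int N}" using R R' assms(1) by auto
      ultimately have "x = x'" by (auto simp: cong_def)
      moreover have "R = insert x (R - {x})" "R' = insert x' (R' - {x'})" using R R' by auto
      ultimately show "R = R' \<and> x = x'" using eq by (metis (no_types))
    qed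
  qed
  moreover have "card (SIGMA R:?G. R) = (\<Sum>R\<in>?G. card R)"
  proof (rule card_SigmaI)
    show "finite ?G" by (rule finite_subset[of _ "Pow A"]) (use fin in auto)
    show "\<forall>R\<in>?G. finite R" using finR by blast
  qed
  moreover have "(\<Sum>R\<in>?G. card R) = card ?G * m" by simp
  moreover have "card ?H = n choose (m - 1)" using fin assms by (simp add: n_subsets)
  ultimately have "card ?G * m \<le> n choose (m - 1)" by simp
  then have G: "real (card ?G) * real m \<le> real (n choose (m - 1))"
    by (simp only: of_nat_mult[symmetric] of_nat_le_iff)
  have ch: "real m * real (n choose m) = (real n - real m + 1) * real (n choose (m - 1))"
  proof -
    obtain k where k: "m = Suc k" using assms by (cases m) auto
    have "real (Suc k) * real (n choose Suc k) = real (n - k) * real (n choose k)"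
      using assms k by (intro real_binomial_Suc_ratio) simp
    then show ?thesis using assms k by (simp add: of_nat_diff)
  qed
  have pos: "0 < real n - real m + 1" "0 < real (n choose m)" "0 < real m" using assms by auto
  have "real m * (real (card ?G) * (real n - real m + 1)) \<le> real m * real (n choose m)"
    using mult_right_mono[OF G, of "real n - real m + 1"] pos unfolding ch by (simp add: mult_ac)
  then have "real (card ?G) * (real n - real m + 1) \<le> real (n choose m)" using pos by simp
  then have "real (card ?G) / real (n choose m) \<le> 1 / (real n - real m + 1)"
    using pos by (simp add: field_simps)
  then show ?thesis using prob_random_subset[OF fin, of m] assms by simp
qed

text \<open>The congruence modulo N is weakened to one modulo q, which is detected by averaging
  characters. The phase carrying z has norm 1, so the bound does not depend on z.\<close>

lemma prob_subset_sum_le_fourier: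
  assumes "finite A" "card A = n" "m \<le> n" "0 < q" "int q dvd N"
  shows "measure_pmf.prob (random_subset m A) {R. [subset_sum R = z] (mod N)}
    \<le> (\<Sum>r\<in>{0..<int q}. norm (\<Sum>R | R \<subseteq> A \<and> card R = m. \<Prod>a\<in>R.
          cis (2 * pi * real_of_int r * real_of_int a / real q)) / real (n choose m)) / real q"
proof -
  let ?S = "{R. R \<subseteq> A \<and> card R = m}"
  let ?E = "\<lambda>r. (\<Sum>R\<in>?S. \<Prod>a\<in>R. cis (2 * pi * real_of_int r * real_of_int a / real q))"
  let ?G = "{R. R \<subseteq> A \<and> card R = m \<and> int q dvd subset_sum R - z}"
  have finS: "finite ?S" using assms by simp
  have "of_nat q * complex_of_real (real (card ?G)) = (\<Sum>R\<in>?S. if int q dvd subset_sum R - z then of_nat q else 0)"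
    using finS by (simp flip: sum.inter_filter add: conj_assoc)
  also have "\<dots> = (\<Sum>R\<in>?S. \<Sum>r\<in>{0..<int q}. cis (2 * pi * real_of_int r * real_of_int (subset_sum R - z) / real q))"
    by (simp only: sum_cis_orthogonality_int[OF assms(4)])
  also have "\<dots> = (\<Sum>R\<in>?S. \<Sum>r\<in>{0..<int q}. cis (- (2 * pi * real_of_int r * real_of_int z / real q)) *
      (\<Prod>a\<in>R. cis (2 * pi * real_of_int r * real_of_int a / real q)))"
  proof (intro sum.cong refl)
    fix R r assume "R \<in> ?S"
    then have "finite R" using assms finite_subset by auto
    then have "(\<Prod>a\<in>R. cis (2 * pi * real_of_int r * real_of_int a / real q))
        = cis (2 * pi * real_of_int r * real_of_int (subset_sum R) / real q)"
      by (simp add: prod_cis subset_sum_def sum_distrib_left sum_divide_distrib)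
    then show "cis (2 * pi * real_of_int r * real_of_int (subset_sum R - z) / real q)
        = cis (- (2 * pi * real_of_int r * real_of_int z / real q)) *
          (\<Prod>a\<in>R. cis (2 * pi * real_of_int r * real_of_int a / real q))"
      by (simp add: cis_mult right_diff_distrib diff_divide_distrib)
  qed
  also have "\<dots> = (\<Sum>r\<in>{0..<int q}. cis (- (2 * pi * real_of_int r * real_of_int z / real q)) * ?E r)"
    by (subst sum.swap) (simp add: sum_distrib_left)
  finally have "norm (of_nat q * complex_of_real (real (card ?G)))
      = norm (\<Sum>r\<in>{0..<int q}. cis (- (2 * pi * real_of_int r * real_of_int z / real q)) * ?E r)"
    by simp
  also have "\<dots> \<le> (\<Sum>r\<in>{0..<int q}. norm (?E r))"
    by (intro sum_norm_le) (simp add: norm_mult)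
  finally have main: "real q * real (card ?G) \<le> (\<Sum>r\<in>{0..<int q}. norm (?E r))"
    by (simp add: norm_mult)
  have "card {R. R \<subseteq> A \<and> card R = m \<and> [subset_sum R = z] (mod N)} \<le> card ?G"
    using assms(5) by (intro card_mono[OF finite_subset[OF _ finS]]) (auto simp: cong_iff_dvd_diff intro: dvd_trans)
  then have "real (card {R. R \<subseteq> A \<and> card R = m \<and> [subset_sum R = z] (mod N)}) \<le> real (card ?G)" by simp
  also have "\<dots> \<le> (\<Sum>r\<in>{0..<int q}. norm (?E r)) / real q"
    using main assms by (simp add: field_simps)
  finally have "real (card {R. R \<subseteq> A \<and> card R = m \<and> [subset_sum R = z] (mod N)}) / real (n choose m)
      \<le> (\<Sum>r\<in>{0..<int q}. norm (?E r)) / real q / real (n choose m)"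
    by (rule divide_right_mono) simp
  also have "\<dots> = (\<Sum>r\<in>{0..<int q}. norm (?E r) / real (n choose m)) / real q"
    by (simp add: sum_divide_distrib mult.commute)
  finally show ?thesis using prob_random_subset[of A m] assms by simp
qed

section \<open>Summation over level sets and the bound for large m\<close>

context cyclic_seminorm
begin

text \<open>Group r by l, the integer part of m \<delta>(r)^2. Level l lies in the ball of radius
  sqrt((l+1)/m), so \<open>growth\<close> gives it at most (l+1)(K / sqrt m + L) points, while each
  term is at most exp(-cl).\<close>

lemma sum_exp_cball_le:
  fixes c K L :: real
  assumes "0 < c" "0 < m" "s0\<^sup>2 \<le> 1" "0 \<le> K" "0 \<le> L"
    and growth: "\<And>s. 0 < s \<Longrightarrow> real (card (cball (min s s0))) \<le> K * s + L"
  shows "(\<Sum>r\<in>cball s0. exp (- (c * real m * (\<delta> r)\<^sup>2)))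
     \<le> 2 / c * exp (c / 2) * (1 + 2 / c) * (K / sqrt (real m) + L)"
proof -
  define lev where "lev r = nat \<lfloor>real m * (\<delta> r)\<^sup>2\<rfloor>" for r
  let ?s = "\<lambda>l. sqrt (real (Suc l) / real m)"
  have nn: "0 \<le> \<delta> r" for r
    using triangle[of r "- r"] by (simp add: zero minus)
  have lev: "real (lev r) \<le> real m * (\<delta> r)\<^sup>2" "real m * (\<delta> r)\<^sup>2 < real (Suc (lev r))" for r
  proof -
    have "0 \<le> real m * (\<delta> r)\<^sup>2" by simp
    then have "real (lev r) = of_int \<lfloor>real m * (\<delta> r)\<^sup>2\<rfloor>" by (simp add: lev_def)
    then show "real (lev r) \<le> real m * (\<delta> r)\<^sup>2" "real m * (\<delta> r)\<^sup>2 < real (Suc (lev r))"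
      by linarith+
  qed
  have levm: "lev r < Suc m" if "r \<in> cball s0" for r
  proof -
    have "(\<delta> r)\<^sup>2 \<le> s0\<^sup>2" using that nn by (intro power_mono) (auto simp: cball_def)
    then have "real m * (\<delta> r)\<^sup>2 \<le> real m * 1" using assms by (intro mult_left_mono) auto
    then have "real (lev r) \<le> real m" using lev(1)[of r] by linarith
    then show ?thesis by simp
  qed
  have mem: "r \<in> cball (min (?s (lev r)) s0)" if "r \<in> cball s0" for r
  proof -
    have "(\<delta> r)\<^sup>2 \<le> real (Suc (lev r)) / real m" using lev(2)[of r] assms by (simp add: field_simps)
    then have "\<delta> r \<le> ?s (lev r)" by (rule real_le_rsqrt)
    then show ?thesis using that by (simp add: cball_def)
  qed
  have "(\<Sum>r\<in>cball s0. exp (- (c * real m * (\<delta> r)\<^sup>2))) \<le> (\<Sum>r\<in>cball s0. exp (- (c * real (lev r))))"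
    using lev(1) assms(1) by (intro sum_mono) (auto intro!: mult_left_mono simp: mult.assoc)
  also have "\<dots> = (\<Sum>l<Suc m. \<Sum>r | r \<in> cball s0 \<and> lev r = l. exp (- (c * real (lev r))))"
    using levm finite_cball by (intro sum.group[symmetric]) auto
  also have "\<dots> = (\<Sum>l<Suc m. real (card {r \<in> cball s0. lev r = l}) * exp (- (c * real l)))"
    by (intro sum.cong refl) simp
  also have "\<dots> \<le> (\<Sum>l<Suc m. (K / sqrt (real m) + L) * (2 / c * exp (c / 2)) * exp (- (c / 2 * real l)))"
  proof (intro sum_mono)
    fix l
    have "card {r \<in> cball s0. lev r = l} \<le> card (cball (min (?s l) s0))"
      using mem by (intro card_mono finite_cball) auto
    then have "real (card {r \<in> cball s0. lev r = l}) \<le> real (card (cball (min (?s l) s0)))" by simp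
    also have "\<dots> \<le> K * ?s l + L" using assms(2) by (intro growth) simp
    also have "\<dots> \<le> real (Suc l) * (K / sqrt (real m) + L)"
    proof -
      have "sqrt (real (Suc l)) \<le> sqrt ((real (Suc l))\<^sup>2)"
        by (intro real_sqrt_le_mono) (simp add: power2_eq_square)
      then have "sqrt (real (Suc l)) \<le> real (Suc l)" by simp
      then have "K / sqrt (real m) * sqrt (real (Suc l)) \<le> K / sqrt (real m) * real (Suc l)"
        using assms by (intro mult_left_mono) auto
      moreover have "1 * L \<le> real (Suc l) * L" using assms by (intro mult_right_mono) auto
      ultimately show ?thesis by (simp add: real_sqrt_divide distrib_left mult_ac del: of_nat_Suc)
    qed
    finally have card: "real (card {r \<in> cball s0. lev r = l}) \<le> real (Suc l) * (K / sqrt (real m) + L)" .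
    \<comment> \<open>Half of the exponent pays for the factor l+1, by y <= exp y; the other half
      leaves a geometric series.\<close>
    have ex: "real (Suc l) * exp (- (c * real l)) \<le> 2 / c * exp (c / 2) * exp (- (c / 2 * real l))"
    proof -
      have "c / 2 * real (Suc l) \<le> exp (c / 2 * real (Suc l))"
        using exp_ge_add_one_self[of "c / 2 * real (Suc l)"] by linarith
      then have "real (Suc l) \<le> 2 / c * exp (c / 2 * real (Suc l))" using assms(1) by (simp add: field_simps)
      then have "real (Suc l) * exp (- (c * real l)) \<le> 2 / c * exp (c / 2 * real (Suc l)) * exp (- (c * real l))"
        by (rule mult_right_mono) simp
      also have "\<dots> = 2 / c * (exp (c / 2 * real (Suc l)) * exp (- (c * real l)))" by simp
      also have "exp (c / 2 * real (Suc l)) * exp (- (c * real l)) = exp (c / 2) * exp (- (c / 2 * real l))"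
        unfolding exp_add[symmetric] by (rule arg_cong[of _ _ exp]) (simp add: field_simps)
      finally show ?thesis by simp
    qed
    have "real (card {r \<in> cball s0. lev r = l}) * exp (- (c * real l))
        \<le> real (Suc l) * (K / sqrt (real m) + L) * exp (- (c * real l))"
      using card by (rule mult_right_mono) simp
    also have "\<dots> = (K / sqrt (real m) + L) * (real (Suc l) * exp (- (c * real l)))" by simp
    also have "\<dots> \<le> (K / sqrt (real m) + L) * (2 / c * exp (c / 2) * exp (- (c / 2 * real l)))"
      using assms by (intro mult_left_mono ex) auto
    finally show "real (card {r \<in> cball s0. lev r = l}) * exp (- (c * real l))
        \<le> (K / sqrt (real m) + L) * (2 / c * exp (c / 2)) * exp (- (c / 2 * real l))"
      by (simp add: mult.assoc)
  qed
  also have "\<dots> = (K / sqrt (real m) + L) * (2 / c * exp (c / 2)) * (\<Sum>l<Suc m. exp (- (c / 2 * real l)))"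
    by (simp only: sum_distrib_left)
  also have "\<dots> \<le> (K / sqrt (real m) + L) * (2 / c * exp (c / 2)) * (1 + 1 / (c / 2))"
    using assms by (intro mult_left_mono sum_exp_neg_le) auto
  finally show ?thesis by (simp add: mult_ac)
qed

end

text \<open>The frequencies are split at |trig_sum| = n/2. Those in the ball are summed by level
  sets and give the term with 1/\<mu>; each of the others contributes at most the last term, hence
  so does their average.\<close>

lemma prob_subset_sum_le_log:
  fixes \<epsilon> \<mu> :: real
  assumes \<epsilon>: "0 < \<epsilon>" "\<epsilon> < 1"
    and q: "0 < q" and A: "A \<subseteq> {0..<int (t * q)}" "card A = n" and n: "4 * t < n"
    and m: "1 \<le> m" "real m \<le> (1 - \<epsilon>) * real n" "4 / \<epsilon> * ln (2 + real n) \<le> real m"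
    and \<mu>: "0 < \<mu>" "\<And>p. prime p \<Longrightarrow> p dvd q \<Longrightarrow> \<mu> \<le> real p"
  shows "measure_pmf.prob (random_subset m A) {R. [subset_sum R = z] (mod int (t * q))}
    \<le> 128 / sqrt \<epsilon> * (2 / \<epsilon> * exp (\<epsilon> / 2) * (1 + 2 / \<epsilon>)) * (40 * real t / (real n * sqrt (real m)) + 1 / \<mu>)
      + 32 / \<epsilon> * (1 / (real n * sqrt (real m)))"
proof -
  define \<delta> where "\<delta> = trig_dist q A"
  interpret cyclic_seminorm q \<delta> unfolding \<delta>_def by (rule trig_dist_cyclic_seminorm[OF q])
  \<comment> \<open>Chosen so that 1 - 2 s0^2 = (1/2)^2: the ball of radius s0 is exactly where the
    trigonometric sum is at least n/2.\<close>
  define s0 where "s0 = sqrt (3 / 8 :: real)"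
  have s0: "0 < s0" "s0\<^sup>2 = 3 / 8" by (auto simp: s0_def)
  have fin: "finite A" using A(1) finite_subset by blast
  have n0: "0 < n" using n by simp
  have mn: "m < n"
  proof -
    have "real m < 1 * real n" using m(2) mult_strict_right_mono[of "1 - \<epsilon>" 1 "real n"] \<epsilon> n0 by linarith
    then show ?thesis by simp
  qed
  have m0: "0 < m" using m by simp
  define \<kappa> where "\<kappa> = real m * (1 - real m / real n)"
  have \<kappa>: "\<epsilon> * real m \<le> \<kappa>"
  proof -
    have "real m / real n \<le> 1 - \<epsilon>" using m(2) n0 by (simp add: field_simps)
    then have "real m * \<epsilon> \<le> real m * (1 - real m / real n)" by (intro mult_left_mono) auto
    then show ?thesis by (simp add: \<kappa>_def mult.commute)
  qed
  have \<kappa>0: "0 < \<kappa>" using \<kappa> \<epsilon> m0 by (smt (verit) mult_pos_pos of_nat_0_less_iff)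
  let ?\<rho> = "\<lambda>r. cmod (trig_sum q A r) / real n"
  have \<rho>: "(?\<rho> r)\<^sup>2 = 1 - 2 * (\<delta> r)\<^sup>2" for r
    using norm_trig_sum_eq_trig_dist[OF fin, of q r] n0 A(2) by (simp add: \<delta>_def power_divide)
  have nn: "0 \<le> \<delta> r" for r
    using triangle[of r "- r"] by (simp add: zero minus)
  have large: "1 / 2 \<le> ?\<rho> r \<longleftrightarrow> \<delta> r \<le> s0" for r
  proof -
    have "1 / 2 \<le> ?\<rho> r \<longleftrightarrow> (1 / 2)\<^sup>2 \<le> (?\<rho> r)\<^sup>2" by (rule power_mono_iff[symmetric]) auto
    also have "\<dots> \<longleftrightarrow> (\<delta> r)\<^sup>2 \<le> s0\<^sup>2" unfolding \<rho> s0(2) by (simp add: power2_eq_square) linarith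
    also have "\<dots> \<longleftrightarrow> \<delta> r \<le> s0" using nn s0 by (intro power_mono_iff) auto
    finally show ?thesis .
  qed
  \<comment> \<open>Each r in the ball contributes at least n^2/4 to the Parseval sum, which is at
    most qnt.\<close>
  have ball0: "real (card (cball s0)) \<le> 4 * real q * real t / real n"
  proof -
    have "real (card (cball s0)) * ((real n)\<^sup>2 / 4) = (\<Sum>r\<in>cball s0. (real n)\<^sup>2 / 4)" by simp
    also have "\<dots> \<le> (\<Sum>r\<in>cball s0. (cmod (trig_sum q A r))\<^sup>2)"
    proof (intro sum_mono)
      fix r assume "r \<in> cball s0"
      then have "\<delta> r \<le> s0" by (simp add: cball_def)
      then have "1 / 2 \<le> ?\<rho> r" using large by blast
      then have "real n / 2 \<le> cmod (trig_sum q A r)" using n0 by (simp add: field_simps)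
      then have "(real n / 2)\<^sup>2 \<le> (cmod (trig_sum q A r))\<^sup>2" by (intro power_mono) auto
      then show "(real n)\<^sup>2 / 4 \<le> (cmod (trig_sum q A r))\<^sup>2" by (simp add: power_divide)
    qed
    also have "\<dots> \<le> (\<Sum>r\<in>{0..<int q}. (cmod (trig_sum q A r))\<^sup>2)"
      by (intro sum_mono2) (auto simp: cball_def)
    also have "\<dots> \<le> real q * real n * real t"
      using sum_norm_trig_sum_power2_le[OF q A(1)] A(2) by simp
    finally show ?thesis using n0 by (simp add: field_simps power2_eq_square)
  qed
  have notall: "\<not> (\<forall>x. \<delta> x \<le> s0)"
  proof
    assume "\<forall>x. \<delta> x \<le> s0"
    then have "cball s0 = {0..<int q}" by (auto simp: cball_def)
    then have "real q \<le> 4 * real q * real t / real n" using ball0 by simp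
    then have "real q * real n \<le> real q * (4 * real t)" using n0 by (simp add: field_simps)
    then have "real n \<le> 4 * real t" using q by simp
    then show False using n by simp
  qed
  have growth: "real (card (cball (min s s0))) \<le> 40 * real q * real t / real n * s + real q / \<mu>" if "0 < s" for s
  proof -
    \<comment> \<open>24 is the 6 of \<open>card_cball_growth\<close> times the 4 of
      \<open>ball0\<close>.\<close>
    have "24 / s0 \<le> 40"
    proof -
      have "0.6 \<le> s0" unfolding s0_def by (rule real_le_rsqrt) (simp add: power2_eq_square)
      then have "24 / s0 \<le> 24 / 0.6" by (intro divide_left_mono) auto
      then show ?thesis by simp
    qed
    then have c: "24 / s0 * (s * real q * real t / real n) \<le> 40 * (s * real q * real t / real n)"
      using that by (intro mult_right_mono) auto
    have "real (card (cball (min s s0))) \<le> 6 * (s / s0) * real (card (cball s0)) + real q / \<mu>"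
      by (rule card_cball_growth[OF that s0(1) notall \<mu>])
    also have "6 * (s / s0) * real (card (cball s0)) \<le> 6 * (s / s0) * (4 * real q * real t / real n)"
      using that s0 by (intro mult_left_mono ball0) auto
    also have "\<dots> \<le> 40 * real q * real t / real n * s" using c by (simp add: mult_ac)
    finally show ?thesis by simp
  qed
  let ?F = "\<lambda>r. norm (\<Sum>R | R \<subseteq> A \<and> card R = m. \<Prod>a\<in>R.
      cis (2 * pi * real_of_int r * real_of_int a / real q)) / real (n choose m)"
  have F_large: "?F r \<le> 128 / sqrt \<epsilon> * exp (- (\<epsilon> * real m * (\<delta> r)\<^sup>2))" if "\<delta> r \<le> s0" for r
  proof -
    have half: "1 / 2 \<le> ?\<rho> r" using that large by blast
    have r1: "?\<rho> r \<le> 1"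
    proof -
      have "(?\<rho> r)\<^sup>2 \<le> 1\<^sup>2" unfolding \<rho> by simp
      then show ?thesis by (rule power2_le_imp_le) simp
    qed
    have "?F r \<le> 128 * sqrt (real m / \<kappa>) * exp (- (\<kappa> * (1 - ?\<rho> r)))"
      using norm_esym_le_large[OF fin A(2) m0 mn _ \<kappa>_def] half unfolding trig_sum_def by simp
    also have "\<dots> \<le> 128 * (1 / sqrt \<epsilon>) * exp (- (\<epsilon> * real m * (\<delta> r)\<^sup>2))"
    proof (intro mult_mono)
      have "real m / \<kappa> \<le> 1 / \<epsilon>" using \<kappa> \<kappa>0 \<epsilon> by (simp add: field_simps)
      then have "sqrt (real m / \<kappa>) \<le> sqrt (1 / \<epsilon>)" by (rule real_sqrt_le_mono)
      then show "sqrt (real m / \<kappa>) \<le> 1 / sqrt \<epsilon>" by (simp add: real_sqrt_divide)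
      \<comment> \<open>Passes from 1 - \<rho>^2 to 1 - \<rho>, the quantity in the exponent of
        \<open>norm_esym_le_large\<close>.\<close>
      have "2 * (\<delta> r)\<^sup>2 = (1 - ?\<rho> r) * (1 + ?\<rho> r)"
        using \<rho>[of r] by (simp add: power2_eq_square algebra_simps)
      also have "\<dots> \<le> (1 - ?\<rho> r) * 2" using r1 by (intro mult_left_mono) auto
      finally have "(\<delta> r)\<^sup>2 \<le> 1 - ?\<rho> r"
        by (metis mult.commute mult_le_cancel_left_pos zero_less_numeral)
      then have "\<epsilon> * real m * (\<delta> r)\<^sup>2 \<le> \<kappa> * (1 - ?\<rho> r)"
        using \<kappa> \<kappa>0 by (intro mult_mono) auto
      then show "exp (- (\<kappa> * (1 - ?\<rho> r))) \<le> exp (- (\<epsilon> * real m * (\<delta> r)\<^sup>2))" by simp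
    qed (use \<epsilon> \<kappa>0 in auto)
    finally show ?thesis by simp
  qed
  have F_small: "?F r \<le> 32 / \<epsilon> * (1 / (real n * sqrt (real m)))" if "\<not> \<delta> r \<le> s0" for r
  proof -
    have half: "?\<rho> r \<le> 1 / 2" using that large[of r] by linarith
    have "?F r \<le> 8 * sqrt (real m) * exp (- (\<kappa> / 2))"
      using norm_esym_le_small[OF fin A(2) m0 mn _ \<kappa>_def] half unfolding trig_sum_def by simp
    also have "\<dots> \<le> 8 * sqrt (real m) * exp (- (\<epsilon> * real m / 2))"
      using \<kappa> by (intro mult_left_mono) auto
    also have "\<dots> \<le> 8 * sqrt (real m) * (4 / (\<epsilon> * real m) * (1 / real n))"
    proof (intro mult_left_mono)
      \<comment> \<open>The exponent is 2y. One factor exp(-y) <= 1/y turns sqrt m into 1 / sqrt m;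
        the other is at most 1/n by the logarithmic lower bound on m.\<close>
      define y where "y = \<epsilon> * real m / 4"
      have y: "0 < y" using \<epsilon> m0 by (simp add: y_def)
      have "y \<le> exp y" using exp_ge_add_one_self[of y] by linarith
      then have e1: "exp (- y) \<le> 1 / y" using y by (simp add: exp_minus field_simps)
      have "ln (2 + real n) \<le> y" using m(3) \<epsilon> by (simp add: y_def field_simps)
      then have "exp (ln (2 + real n)) \<le> exp y" by (simp only: exp_le_cancel_iff)
      moreover have "exp (ln (2 + real n)) = 2 + real n" by (rule exp_ln) simp
      ultimately have "2 + real n \<le> exp y" by (simp only:)
      then have "exp (- y) \<le> 1 / (2 + real n)" by (simp add: exp_minus field_simps)
      also have "\<dots> \<le> 1 / real n" using n0 by (intro divide_left_mono) auto
      finally have e2: "exp (- y) \<le> 1 / real n" .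
      have "exp (- (\<epsilon> * real m / 2)) = exp (- y) * exp (- y)"
        unfolding exp_add[symmetric] by (simp add: y_def)
      also have "\<dots> \<le> 1 / y * (1 / real n)" using e1 e2 y by (intro mult_mono) auto
      finally show "exp (- (\<epsilon> * real m / 2)) \<le> 4 / (\<epsilon> * real m) * (1 / real n)" by (simp add: y_def)
    qed simp
    also have "\<dots> = 32 / \<epsilon> * (sqrt (real m) / real m * (1 / real n))" by simp
    also have "sqrt (real m) / real m = 1 / sqrt (real m)"
      by (simp add: sqrt_divide_self_eq inverse_eq_divide)
    finally show ?thesis by (simp add: mult.commute)
  qed
  let ?K = "2 / \<epsilon> * exp (\<epsilon> / 2) * (1 + 2 / \<epsilon>)"
  let ?S = "32 / \<epsilon> * (1 / (real n * sqrt (real m)))"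
  have S0: "0 \<le> ?S" using \<epsilon> by simp
  have "(\<Sum>r\<in>{0..<int q}. ?F r) = (\<Sum>r\<in>cball s0. ?F r) + (\<Sum>r\<in>{0..<int q} - cball s0. ?F r)"
    by (rule trans[OF sum.subset_diff add.commute]) (auto simp: cball_def)
  also have "(\<Sum>r\<in>cball s0. ?F r) \<le> (\<Sum>r\<in>cball s0. 128 / sqrt \<epsilon> * exp (- (\<epsilon> * real m * (\<delta> r)\<^sup>2)))"
    by (intro sum_mono F_large) (simp add: cball_def)
  also have "\<dots> = 128 / sqrt \<epsilon> * (\<Sum>r\<in>cball s0. exp (- (\<epsilon> * real m * (\<delta> r)\<^sup>2)))"
    by (simp only: sum_distrib_left)
  also have "\<dots> \<le> 128 / sqrt \<epsilon> * (?K * (40 * real q * real t / real n / sqrt (real m) + real q / \<mu>))"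
    using \<epsilon> s0 m0 \<mu>(1) growth by (intro mult_left_mono sum_exp_cball_le) auto
  also have "(\<Sum>r\<in>{0..<int q} - cball s0. ?F r) \<le> (\<Sum>r\<in>{0..<int q} - cball s0. ?S)"
    by (intro sum_mono F_small) (simp add: cball_def)
  also have "\<dots> \<le> (\<Sum>r\<in>{0..<int q}. ?S)" using S0 by (intro sum_mono2) auto
  also have "\<dots> = real q * ?S" by simp
  finally have "(\<Sum>r\<in>{0..<int q}. ?F r) / real q
      \<le> (128 / sqrt \<epsilon> * (?K * (40 * real q * real t / real n / sqrt (real m) + real q / \<mu>)) + real q * ?S) / real q"
    by (intro divide_right_mono) auto
  also have "\<dots> = (128 / sqrt \<epsilon> * (?K * (real q * (40 * real t / (real n * sqrt (real m)) + 1 / \<mu>))) + real q * ?S) / real q"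
    by (simp add: distrib_left mult_ac)
  also have "\<dots> = 128 / sqrt \<epsilon> * ?K * (40 * real t / (real n * sqrt (real m)) + 1 / \<mu>) + ?S"
    using q by (simp add: add_divide_distrib)
  finally have "(\<Sum>r\<in>{0..<int q}. ?F r) / real q
      \<le> 128 / sqrt \<epsilon> * ?K * (40 * real t / (real n * sqrt (real m)) + 1 / \<mu>) + ?S" .
  then show ?thesis
    using prob_subset_sum_le_fourier[OF fin A(2) _ q, of m "int (t * q)" z] mn by simp
qed

section \<open>Choice of the constant and the three ranges of parameters\<close>

theorem proposition3p3:
  fixes \<epsilon> T :: real
  assumes "0 < \<epsilon>" and "\<epsilon> < 1" and "1 \<le> T"
  shows "\<exists>C::real. C > 0 \<and>
    (\<forall>(N::nat) (t::nat) (q::nat) (A::int set) (n::nat) (m::nat) (z::int).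
       N = t * q \<and> 1 \<le> t \<and> real t \<le> T \<and> 0 < q \<and> coprime t q \<and>
       A \<subseteq> {0..<int N} \<and> card A = n \<and> 2 \<le> n \<and>
       1 \<le> m \<and> real m \<le> (1 - \<epsilon>) * real n \<and>
       z \<in> {0..<int N} \<longrightarrow>
       measure_pmf.prob (random_subset m A) {R. [subset_sum R = z] (mod int N)}
         \<le> 1 / real N + C * (sqrt (ln (2 + real n)) / (real n * sqrt (real m))
              + real_of_ereal (1 / ereal_of_enat (P_minus q))))"
proof -
  \<comment> \<open>\<open>D\<close> and \<open>C3\<close> come from
    \<open>prob_subset_sum_le_log\<close>, \<open>C1\<close> serves n <= 4t, and \<open>C2\<close>
    serves m below a multiple of log n.\<close>
  define D where "D = 128 / sqrt \<epsilon> * (2 / \<epsilon> * exp (\<epsilon> / 2) * (1 + 2 / \<epsilon>))"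
  define C1 where "C1 = 16 * T\<^sup>2"
  define C2 where "C2 = sqrt (4 / \<epsilon>) / \<epsilon>"
  define C3 where "C3 = D * 40 * T + 32 / \<epsilon>"
  have C: "0 < D" "0 < C1" "0 < C2" "0 < C3"
    using assms by (auto simp: D_def C1_def C2_def C3_def intro!: add_pos_pos mult_pos_pos divide_pos_pos)
  show ?thesis
  proof (intro exI[of _ "C1 + C2 + C3 + D"] conjI allI impI; (elim conjE)?)
    show "0 < C1 + C2 + C3 + D" using C by simp
    fix N t q :: nat and A :: "int set" and n m :: nat and z :: int
    assume N: "N = t * q" and t: "1 \<le> t" "real t \<le> T" and q: "0 < q"
      and A: "A \<subseteq> {0..<int N}" "card A = n" and n: "2 \<le> n"
      and m: "1 \<le> m" "real m \<le> (1 - \<epsilon>) * real n"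
    let ?P = "measure_pmf.prob (random_subset m A) {R. [subset_sum R = z] (mod int N)}"
    let ?L = "sqrt (ln (2 + real n))"
    let ?B = "real n * sqrt (real m)"
    let ?I = "real_of_ereal (1 / ereal_of_enat (P_minus q))"
    have B: "0 < ?B" using n m by simp
    have L: "1 \<le> ?L"
    proof -
      have "2 \<le> real n" using n by simp
      then have "exp 1 \<le> 2 + real n" using exp_le by linarith
      then have "1 \<le> ln (2 + real n)" by (subst ln_ge_iff) auto
      then show ?thesis by simp
    qed
    have I: "0 \<le> ?I" by (cases "P_minus q") (auto simp: real_of_ereal_pos)
    have goal: "?P \<le> 1 / real N + (C1 + C2 + C3 + D) * (?L / ?B + ?I)"
      if "?P \<le> (C1 + C2 + C3) * (?L / ?B) + D * ?I"
    proof -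
      have "(C1 + C2 + C3) * (?L / ?B) \<le> (C1 + C2 + C3 + D) * (?L / ?B)"
        using C B L by (intro mult_right_mono) auto
      moreover have "D * ?I \<le> (C1 + C2 + C3 + D) * ?I"
        using C I by (intro mult_right_mono) auto
      moreover have "0 \<le> 1 / real N" by simp
      ultimately show ?thesis using that unfolding distrib_left by linarith
    qed
    have mn: "real m \<le> real n"
    proof -
      have "(1 - \<epsilon>) * real n \<le> 1 * real n" using assms by (intro mult_right_mono) auto
      then show ?thesis using m by linarith
    qed
    consider "n \<le> 4 * t" | "real m < 4 / \<epsilon> * ln (2 + real n)"
      | "4 * t < n" "4 / \<epsilon> * ln (2 + real n) \<le> real m" by linarith
    then show "?P \<le> 1 / real N + (C1 + C2 + C3 + D) * (?L / ?B + ?I)"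
    proof cases
      case 1
      \<comment> \<open>Both n and sqrt m are at most 4T, so the claimed bound already exceeds
        1.\<close>
      have "?B \<le> (4 * T) * (4 * T)"
      proof (rule mult_mono)
        have "real n \<le> 4 * real t" using 1 by (metis of_nat_le_iff of_nat_mult of_nat_numeral)
        then show nT: "real n \<le> 4 * T" using t by simp
        have "sqrt (real m) \<le> sqrt ((real m)\<^sup>2)"
          using m by (intro real_sqrt_le_mono) (simp add: power2_eq_square)
        then show "sqrt (real m) \<le> 4 * T" using nT mn by simp
      qed (use assms in auto)
      then have "?B \<le> C1 * ?L" using mult_left_mono[OF L, of C1] C by (simp add: C1_def power2_eq_square)
      then have "1 \<le> C1 * (?L / ?B)" using B by (simp add: field_simps)
      moreover have "?P \<le> 1" by simp
      moreover have "0 \<le> C2 * (?L / ?B)" "0 \<le> C3 * (?L / ?B)" "0 \<le> D * ?I"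
        using C B L I by auto
      ultimately have "?P \<le> (C1 + C2 + C3) * (?L / ?B) + D * ?I"
        unfolding distrib_right by linarith
      then show ?thesis by (rule goal)
    next
      case 2
      have "?P \<le> 1 / (real n - real m + 1)"
        using A m mn by (intro prob_subset_sum_le_trivial) auto
      also have "\<dots> \<le> 1 / (\<epsilon> * real n)"
      proof (rule divide_left_mono)
        show "\<epsilon> * real n \<le> real n - real m + 1" using m(2) by (simp add: algebra_simps)
        show "0 < (real n - real m + 1) * (\<epsilon> * real n)" using mn assms n by (intro mult_pos_pos) auto
      qed simp
      also have "\<dots> \<le> C2 * (?L / ?B)"
      proof -
        \<comment> \<open>The trivial bound lacks the factor 1 / sqrt m; in this range sqrt m is at
          most a constant times the square root of the logarithm in the claim.\<close>
        have "sqrt (real m) \<le> sqrt (4 / \<epsilon> * ln (2 + real n))" using 2 by simp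
        then have "sqrt (real m) \<le> sqrt (4 / \<epsilon>) * ?L" by (simp only: real_sqrt_mult)
        then have "sqrt (real m) / (\<epsilon> * ?B) \<le> sqrt (4 / \<epsilon>) * ?L / (\<epsilon> * ?B)"
          using assms B by (intro divide_right_mono) auto
        then show ?thesis using m assms n unfolding C2_def by simp
      qed
      finally have "?P \<le> C2 * (?L / ?B)" .
      moreover have "0 \<le> C1 * (?L / ?B)" "0 \<le> C3 * (?L / ?B)" "0 \<le> D * ?I"
        using C B L I by auto
      ultimately have "?P \<le> (C1 + C2 + C3) * (?L / ?B) + D * ?I"
        unfolding distrib_right by linarith
      then show ?thesis by (rule goal)
    next
      case 3
      \<comment> \<open>For q = 1 the set \<open>A\<close> would have at most t elements, against n
        > 4t. Hence a least prime divisor exists and \<open>P_minus q\<close> is finite.\<close>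
      have "q \<noteq> 1"
      proof
        assume "q = 1"
        then have "card A \<le> card {0..<int t}" using A N by (intro card_mono) auto
        then show False using 3 A by simp
      qed
      define p0 where "p0 = (LEAST p. prime p \<and> p dvd q)"
      have p0: "prime p0" "p0 dvd q"
        using LeastI_ex[of "\<lambda>p. prime p \<and> p dvd q"] prime_factor_nat[OF \<open>q \<noteq> 1\<close>] unfolding p0_def by auto
      have p0_le: "real p0 \<le> real p" if "prime p" "p dvd q" for p
        using Least_le[of "\<lambda>p. prime p \<and> p dvd q" p] that unfolding p0_def by simp
      have p0_pos: "0 < real p0" using p0(1) prime_gt_0_nat by simp
      have Ip: "?I = 1 / real p0"
        unfolding P_minus_eq_Least[OF \<open>q \<noteq> 1\<close>] p0_def[symmetric] using p0_pos
        by (simp add: one_ereal_def)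
      have "?P \<le> D * (40 * real t / ?B + 1 / real p0) + 32 / \<epsilon> * (1 / ?B)"
        unfolding D_def N
        using assms q A N 3 m p0_pos p0_le by (intro prob_subset_sum_le_log) auto
      also have "\<dots> = (D * 40 * real t + 32 / \<epsilon>) * (1 / ?B) + D * ?I"
        unfolding Ip by (simp add: algebra_simps add_divide_distrib)
      also have "(D * 40 * real t + 32 / \<epsilon>) * (1 / ?B) \<le> C3 * (?L / ?B)"
      proof (intro mult_mono)
        show "D * 40 * real t + 32 / \<epsilon> \<le> C3" unfolding C3_def using t C by simp
        show "1 / ?B \<le> ?L / ?B" using L B by (intro divide_right_mono) auto
      qed (use C B in auto)
      finally have "?P \<le> C3 * (?L / ?B) + D * ?I" by simp
      moreover have "0 \<le> C1 * (?L / ?B)" "0 \<le> C2 * (?L / ?B)"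
        using C B L I by auto
      ultimately have "?P \<le> (C1 + C2 + C3) * (?L / ?B) + D * ?I"
        unfolding distrib_right by linarith
      then show ?thesis by (rule goal)
    qed
  qed
qed

end
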